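(* Let $A\in\mathbb{R}^{m\times N}$ and $f\in\mathbb{R}^m$ be arbitrary. The generalized homotopy method (described in the context) applied to $(A,f)$ terminates after finitely many iterations. Furthermore, let $t^0=\|A^Tf\|_\infty>t^1>\dots>t^K=0$ and $u(t^0),\dots,u(t^K)$ be its output, and define $u\colon\mathbb{R}_{\ge 0}\to\mathbb{R}^N$ by $$u(t)=\begin{cases}0 & \text{if } t\ge t^0,\\[2pt] \dfrac{t-t^k}{t^{k-1}-t^k}\,u(t^{k-1})+\dfrac{t^{k-1}-t}{t^{k-1}-t^k}\,u(t^k) & \text{if } t\in[t^k,t^{k-1}),\ 1\le k\le K.\end{cases}$$ Then $u$ is piecewise linear, continuous, and satisfies $u(t)\in U_t=\operatorname{argmin}_{u\in\mathbb{R}^N}\frac12\|Au-f\|_2^2+t\|u\|_1$ for all $t>0$ as well as $u(0)\in U_0$.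
   Context: Notation. $[N]=\{1,\dots,N\}$; $A_i$ is the $i$-th column of $A$; for $S\subseteq[N]$, $A_S$ is the submatrix of columns indexed by $S$ and $v_S$ the subvector of $v\in\mathbb{R}^N$ indexed by $S$; $S^C=[N]\setminus S$. For $t>0$, $U_t:=\operatorname{argmin}_{u\in\mathbb{R}^N}\frac12\|Au-f\|_2^2+t\|u\|_1$ (the set of minimizers), and $U_0:=\operatorname{argmin}\{\|u\|_1: u\in\mathbb{R}^N,\ A^T(Au-f)=0\}$. The active set of $u\in\mathbb{R}^N$ is $\mathcal{A}(u)=\{i\in[N]:u_i\ne0\}$. The equicorrelation set is $\mathcal{E}(t,u)=\{i\in[N]:|A_i^T(Au-f)|=t\}$. Generalized homotopy method. Initialize $t^0=\|A^Tf\|_\infty$, $u(t^0)=0$. For $j=0,1,2,\dots$: (1) If $t^j=0$, stop and set $K=j$. (2) Put $r^j=f-Au(t^j)$, $p(t^j)=\frac1{t^j}A^Tr^j$, $\mathcal{E}=\mathcal{E}(t^j,u(t^j))$, $\mathcal{A}=\mathcal{A}(u(t^j))$. (3) Let $\mathcal{D}$ be the set of minimizers of $\|Ad-\frac1{t^j}r^j\|_2^2$ over all $d\in\mathbb{R}^N$ with $d_{\mathcal{E}^C}=0$ and $d_i\,p(t^j)_i\ge0$ for all $i\in\mathcal{E}\setminus\mathcal{A}$, and let $d^{j+1}$ be the (unique) element of $\mathcal{D}$ of minimal $\ell_2$-norm. (4) Let $t^{j+1}\ge0$ be the minimal number such that $u(t):=u(t^j)+(t^j-t)d^{j+1}\in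 U_t$ for all $t\in[t^{j+1},t^j]$; set $u(t^{j+1})=u(t^j)+(t^j-t^{j+1})d^{j+1}$. The output is $K$, $t^0,\dots,t^K$ and $u(t^0),\dots,u(t^K)$. *)

theory Defs
  imports "HOL-Analysis.Analysis"
begin

definition l1_norm :: "real^'n \<Rightarrow> real" where
  "l1_norm u = (\<Sum>i\<in>UNIV. \<bar>u $ i\<bar>)"

text \<open>The solution sets $U_t$, only meaningful for $t \ge 0$. At $t = 0$ the set is not the argmin
  of the objective with $t = 0$, but the set of least-squares solutions of minimal $\ell_1$-norm.\<close>

definition lasso_solutions :: "real^'n^'m \<Rightarrow> real^'m \<Rightarrow> real \<Rightarrow> (real^'n) set" where
  "lasso_solutions A f t =
     (if t = 0
      then {u. is_arg_min l1_norm (\<lambda>u. transpose A *v (A *v u - f) = 0) u}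
      else {u. is_arg_min (\<lambda>u. 1/2 * (norm (A *v u - f))\<^sup>2 + t * l1_norm u) (\<lambda>_. True) u})"

definition active_set :: "real^'n \<Rightarrow> 'n set" where
  "active_set u = {i. u $ i \<noteq> 0}"

definition equicorrelation_set :: "real^'n^'m \<Rightarrow> real^'m \<Rightarrow> real \<Rightarrow> real^'n \<Rightarrow> 'n set" where
  "equicorrelation_set A f t u = {i. \<bar>column i A \<bullet> (A *v u - f)\<bar> = t}"

definition direction_set :: "real^'n^'m \<Rightarrow> real^'m \<Rightarrow> real \<Rightarrow> real^'n \<Rightarrow> (real^'n) set" where
  "direction_set A f t u =
     (let r = f - A *v u;
          p = (1 / t) *\<^sub>R (transpose A *v r);
          E = equicorrelation_set A f t u
      in {d. is_arg_min (\<lambda>d. (norm (A *v d - (1 / t) *\<^sub>R r))\<^sup>2)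
               (\<lambda>d. (\<forall>i. i \<notin> E \<longrightarrow> d $ i = 0) \<and>
                    (\<forall>i \<in> E - active_set u. d $ i * p $ i \<ge> 0)) d})"

text \<open>One iteration, from \<open>(t, u)\<close> with \<open>t \<noteq> 0\<close> to \<open>(t', u')\<close>. It is a relation, so that neither the
  existence of the direction \<open>d\<close> and of the minimal \<open>t'\<close> nor the uniqueness of the successor is
  presupposed.\<close>

definition homotopy_step ::
    "real^'n^'m \<Rightarrow> real^'m \<Rightarrow> real \<Rightarrow> real^'n \<Rightarrow> real \<Rightarrow> real^'n \<Rightarrow> bool" where
  "homotopy_step A f t u t' u' \<longleftrightarrow>
     t \<noteq> 0 \<and>
     (\<exists>d. is_arg_min norm (\<lambda>d. d \<in> direction_set A f t u) d \<and>
          (let S = {s \<in> {0..t}. \<forall>\<tau>\<in>{s..t}. u + (t - \<tau>) *\<^sub>R d \<in> lasso_solutions A f \<tau>}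
           in t' \<in> S \<and> (\<forall>s\<in>S. t' \<le> s)) \<and>
          u' = u + (t - t') *\<^sub>R d)"

text \<open>The first \<open>K\<close> iterations of an execution; entries of \<open>t\<close> and \<open>u\<close> beyond index \<open>K\<close> are
  irrelevant.\<close>

definition homotopy_run ::
    "real^'n^'m \<Rightarrow> real^'m \<Rightarrow> nat \<Rightarrow> (nat \<Rightarrow> real) \<Rightarrow> (nat \<Rightarrow> real^'n) \<Rightarrow> bool" where
  "homotopy_run A f K t u \<longleftrightarrow>
     t 0 = infnorm (transpose A *v f) \<and> u 0 = 0 \<and>
     (\<forall>j<K. homotopy_step A f (t j) (u j) (t (Suc j)) (u (Suc j)))"

definition homotopy_output ::
    "real^'n^'m \<Rightarrow> real^'m \<Rightarrow> nat \<Rightarrow> (nat \<Rightarrow> real) \<Rightarrow> (nat \<Rightarrow> real^'n) \<Rightarrow> bool" where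
  "homotopy_output A f K t u \<longleftrightarrow> homotopy_run A f K t u \<and> t K = 0"

text \<open>The index \<open>k\<close> below is well defined for \<open>0 \<le> s < t 0\<close> when \<open>t 0 > \<dots> > t K = 0\<close>.\<close>

definition homotopy_path ::
    "nat \<Rightarrow> (nat \<Rightarrow> real) \<Rightarrow> (nat \<Rightarrow> real^'n) \<Rightarrow> real \<Rightarrow> real^'n" where
  "homotopy_path K t u s =
     (if s \<ge> t 0 then 0
      else let k = (THE k. 1 \<le> k \<and> k \<le> K \<and> s \<in> {t k..<t (k - 1)})
           in ((s - t k) / (t (k - 1) - t k)) *\<^sub>R u (k - 1) +
              ((t (k - 1) - s) / (t (k - 1) - t k)) *\<^sub>R u k)"

lemma homotopy_path_eq:
  assumes "\<And>j. j < K \<Longrightarrow> t (Suc j) < t j" "1 \<le> k" "k \<le> K" "s \<in> {t k..<t (k - 1)}"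
  shows "homotopy_path K t u s =
           ((s - t k) / (t (k - 1) - t k)) *\<^sub>R u (k - 1) +
           ((t (k - 1) - s) / (t (k - 1) - t k)) *\<^sub>R u k"
proof -
  have anti: "t j \<le> t i" if "i \<le> j" "j \<le> K" for i j
    using that
  proof (induction j rule: dec_induct)
    case (step n)
    then show ?case using assms(1)[of n] by auto
  qed simp
  have "(THE k. 1 \<le> k \<and> k \<le> K \<and> s \<in> {t k..<t (k - 1)}) = k"
  proof (rule the_equality)
    fix l assume l: "1 \<le> l \<and> l \<le> K \<and> s \<in> {t l..<t (l - 1)}"
    show "l = k"
    proof (rule linorder_cases[of l k])
      assume "l < k"
      then have "t (k - 1) \<le> t l" using assms by (intro anti) auto
      then show ?thesis using l assms by auto
    next
      assume "k < l"
      then have "t (l - 1) \<le> t k" using l by (intro anti) auto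
      then show ?thesis using l assms by auto
    qed
  qed (use assms in auto)
  moreover have "t (k - 1) \<le> t 0" using assms by (intro anti) auto
  ultimately show ?thesis using assms by (simp add: homotopy_path_def)
qed

text \<open>As usual, ``linear'' on each piece means affine.\<close>

definition piecewise_linear_on :: "real set \<Rightarrow> (real \<Rightarrow> 'a::real_vector) \<Rightarrow> bool" where
  "piecewise_linear_on I g \<longleftrightarrow>
     (\<exists>P. finite P \<and> \<Union>P = I \<and>
          (\<forall>J\<in>P. is_interval J \<and> (\<exists>a b. \<forall>s\<in>J. g s = a + s *\<^sub>R b)))"

end

theory Submission
  imports Defs
begin

text \<open>Write $q(u) = A^T(f - Au)$. For $t > 0$, $u \in U_t$ means $|q_i| \le t$ and
  $u_i q_i = t |u_i|$ for all $i$, and $q$ is constant on $U_t$. The optimality conditions for the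
  direction $d$ ensure that these conditions persist for parameters slightly below $t$, so every
  step makes progress; they are closed, so the minimal next parameter exists.

  For termination, the direction depends only on the active set of $u$ and on the signs of $q$ on
  the equicorrelation set, and this pattern never recurs. Suppose it did, at steps $i < j$.
  Interpolating between the two solutions shows that the signs are constant on $[t^j, t^i]$, whence
  $A^T A d = q/t$ on the equicorrelation set for all directions in between. So the previous
  direction stays least-squares optimal at each breakpoint and can only be abandoned because it
  violates a newly arisen sign constraint. A short move from the old towards the new direction
  is admissible for the old problem, so the old minimum-norm direction is strictly shorter than
  the new one. The norms of the directions therefore increase strictly from step $i$ to step $j$,
  although the directions at both steps are equal.\<close>

section \<open>Least squares over convex sets\<close>

text \<open>Dividing by \<theta> and letting it tend to 0 leaves b. This turns minimality along a
  segment into a first-order condition.\<close>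

lemma small_perturbation_nonneg:
  fixes a b :: real
  assumes "\<And>\<theta>. 0 < \<theta> \<Longrightarrow> \<theta> \<le> 1 \<Longrightarrow> 0 \<le> \<theta>\<^sup>2 * a + \<theta> * b"
  shows "0 \<le> b"
proof (rule ccontr)
  assume "\<not> 0 \<le> b"
  \<comment> \<open>This choice makes \<theta> * \<bar>a\<bar> + b equal to \<theta> * b, which is
    negative.\<close>
  define \<theta> where "\<theta> = - b / (\<bar>a\<bar> - b)"
  have \<theta>: "0 < \<theta>" "\<theta> \<le> 1" and eq: "\<theta> * (\<bar>a\<bar> - b) = - b"
    using \<open>\<not> 0 \<le> b\<close> by (auto simp: \<theta>_def field_simps)
  have "\<theta> * (\<theta> * a + b) \<ge> 0"
    using assms[OF \<theta>] by (simp add: power2_eq_square algebra_simps)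
  then have "\<theta> * a + b \<ge> 0"
    using \<theta> by (simp add: zero_le_mult_iff)
  moreover have "\<theta> * a \<le> \<theta> * \<bar>a\<bar>"
    using \<theta> by (intro mult_left_mono) auto
  moreover have "\<theta> * b < 0"
    using \<theta> \<open>\<not> 0 \<le> b\<close> by (simp add: mult_pos_neg)
  ultimately show False
    using eq by (simp add: algebra_simps)
qed

lemma power2_norm_add_scaleR:
  fixes v w :: "'a::real_inner"
  shows "(norm (v + c *\<^sub>R w))\<^sup>2 = (norm v)\<^sup>2 + c * (2 * (v \<bullet> w)) + c\<^sup>2 * (norm w)\<^sup>2"
  unfolding power2_norm_eq_inner
  by (simp add: inner_add_left inner_add_right inner_commute power2_eq_square algebra_simps)

text \<open>The objective is a quadratic polynomial along the segment from d to x. The variational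
  inequality says that its linear coefficient is nonnegative. Conversely, evaluating at the endpoint
  x suffices, since the quadratic term is nonnegative.\<close>

lemma least_squares_arg_min_iff:
  fixes L :: "'a::real_vector \<Rightarrow> 'b::real_inner"
  assumes "linear L" "convex {d. C d}"
  shows "is_arg_min (\<lambda>d. (norm (L d - b))\<^sup>2) C d \<longleftrightarrow>
         C d \<and> (\<forall>x. C x \<longrightarrow> 0 \<le> (L d - b) \<bullet> L (x - d))"
proof -
  interpret L: linear L by fact
  have expand: "(norm (L (d + c *\<^sub>R (x - d)) - b))\<^sup>2 =
      (norm (L d - b))\<^sup>2 + c * (2 * ((L d - b) \<bullet> L (x - d))) + c\<^sup>2 * (norm (L (x - d)))\<^sup>2" for c x
  proof -
    have "L (d + c *\<^sub>R (x - d)) - b = (L d - b) + c *\<^sub>R L (x - d)"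
      by (simp only: L.add L.scaleR) simp
    then show ?thesis
      by (simp only: power2_norm_add_scaleR)
  qed
  show ?thesis
    unfolding is_arg_min_linorder
  proof (intro conj_cong refl iffI allI impI)
    fix x assume C: "C d" "C x" and min: "\<forall>y. C y \<longrightarrow> (norm (L d - b))\<^sup>2 \<le> (norm (L y - b))\<^sup>2"
    have "0 \<le> 2 * ((L d - b) \<bullet> L (x - d))"
    proof (rule small_perturbation_nonneg)
      fix \<theta> :: real assume \<theta>: "0 < \<theta>" "\<theta> \<le> 1"
      have "d + \<theta> *\<^sub>R (x - d) = (1 - \<theta>) *\<^sub>R d + \<theta> *\<^sub>R x"
        by (simp add: algebra_simps)
      then have "C (d + \<theta> *\<^sub>R (x - d))"
        using convexD_alt[OF assms(2), of d x \<theta>] C \<theta> by simp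
      then show "0 \<le> \<theta>\<^sup>2 * (norm (L (x - d)))\<^sup>2 + \<theta> * (2 * ((L d - b) \<bullet> L (x - d)))"
        using min expand[of \<theta> x] by fastforce
    qed
    then show "0 \<le> (L d - b) \<bullet> L (x - d)" by simp
  next
    fix y assume "C y" "\<forall>x. C x \<longrightarrow> 0 \<le> (L d - b) \<bullet> L (x - d)"
    then show "(norm (L d - b))\<^sup>2 \<le> (norm (L y - b))\<^sup>2"
      using expand[of 1 y] by simp
  qed
qed

text \<open>This is the previous characterization for the identity map and target 0: the minimizer
  is the projection of the origin onto D.\<close>

lemma min_norm_iff:
  fixes d :: "'a::real_inner"
  assumes "convex D"
  shows "is_arg_min norm (\<lambda>d. d \<in> D) d \<longleftrightarrow> d \<in> D \<and> (\<forall>x\<in>D. 0 \<le> d \<bullet> (x - d))"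
proof -
  have "is_arg_min norm (\<lambda>d. d \<in> D) d = is_arg_min (\<lambda>d. (norm (d - 0))\<^sup>2) (\<lambda>d. d \<in> D) d"
    by (simp add: is_arg_min_linorder power_mono_iff)
  also have "\<dots> \<longleftrightarrow> d \<in> D \<and> (\<forall>x. x \<in> D \<longrightarrow> 0 \<le> (d - 0) \<bullet> (x - d))"
    using assms by (intro least_squares_arg_min_iff) (simp_all add: linear_ident)
  finally show ?thesis by auto
qed

lemma min_norm_less:
  fixes d :: "'a::real_inner"
  assumes "0 \<le> d \<bullet> (x - d)" "x \<noteq> d"
  shows "norm d < norm x"
proof -
  have "(norm x)\<^sup>2 = (norm d)\<^sup>2 + 2 * (d \<bullet> (x - d)) + (norm (x - d))\<^sup>2"
    by (simp add: power2_norm_eq_inner inner_diff_left inner_diff_right inner_commute)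
  moreover have "(norm (x - d))\<^sup>2 > 0" using assms by simp
  ultimately have "(norm d)\<^sup>2 < (norm x)\<^sup>2" using assms(1) by linarith
  then show ?thesis by (rule power2_less_imp_less) simp
qed

lemma min_norm_unique:
  fixes d :: "'a::real_inner"
  assumes "convex D" "is_arg_min norm (\<lambda>d. d \<in> D) d" "is_arg_min norm (\<lambda>d. d \<in> D) e"
  shows "d = e"
proof (rule ccontr)
  assume "d \<noteq> e"
  have "d \<in> D" "e \<in> D" "norm e \<le> norm d"
    using assms(2,3) by (auto simp: is_arg_min_linorder)
  moreover have "0 \<le> d \<bullet> (e - d)"
    using assms(1,2) \<open>e \<in> D\<close> by (simp add: min_norm_iff)
  ultimately show False
    using min_norm_less[of d e] \<open>d \<noteq> e\<close> by simp
qed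

text \<open>A linear image of a closed convex cone may fail to be closed. Here the hypothesis
  \<open>axes\<close> makes F finitely generated, by signed unit vectors, so its image is a finitely
  generated cone and hence closed.\<close>

lemma closed_linear_image_convex_cone:
  fixes F :: "(real^'n) set" and L :: "real^'n \<Rightarrow> 'b::euclidean_space"
  assumes "linear L" "convex_cone F" and axes: "\<And>d i. d \<in> F \<Longrightarrow> axis i (sgn (d $ i)) \<in> F"
  shows "closed (L ` F)"
proof -
  \<comment> \<open>The value c = 0 is included because \<open>sgn (d $ i)\<close> vanishes when the
    coordinate does.\<close>
  define G :: "(real^'n) set" where "G = F \<inter> (\<lambda>(i, c). axis i c) ` (UNIV \<times> {-1, 0, 1})"
  have "F \<subseteq> convex_cone hull G"
  proof
    fix d assume d: "d \<in> F"
    have "axis i (sgn (d $ i)) \<in> G" for i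
      using axes[OF d] by (force simp: G_def sgn_if)
    then have "\<bar>d $ i\<bar> *\<^sub>R axis i (sgn (d $ i)) \<in> convex_cone hull G" for i
      by (intro convex_cone_hull_mul hull_inc) auto
    moreover have "\<bar>d $ i\<bar> *\<^sub>R axis i (sgn (d $ i)) = axis i (d $ i)" for i
      by (auto simp: axis_def vec_eq_iff abs_mult_sgn)
    ultimately have ax: "axis i (d $ i) \<in> convex_cone hull G" for i
      by metis
    have "(\<Sum>i\<in>I. axis i (d $ i)) \<in> convex_cone hull G" if "finite I" for I
      using that
      by (induction I) (auto intro: convex_cone_hull_add ax convex_cone_hull_contains_0)
    moreover have "(\<Sum>i\<in>UNIV. axis i (d $ i)) = d"
      by (simp add: vec_eq_iff axis_def)
    ultimately show "d \<in> convex_cone hull G" by (metis finite)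
  qed
  moreover have "convex_cone hull G \<subseteq> F"
    by (rule hull_minimal) (simp_all add: G_def assms(2))
  ultimately have "F = convex_cone hull G" by blast
  then have "L ` F = convex_cone hull (L ` G)"
    using assms(1) by (simp add: convex_cone_hull_linear_image)
  then show ?thesis
    by (simp add: G_def closed_convex_cone_hull)
qed

section \<open>Optimality conditions for the Lasso\<close>

text \<open>The negative gradient of the least-squares term, that is, t times the vector p(t) of the
  method.\<close>

definition correlation :: "real^'n^'m \<Rightarrow> real^'m \<Rightarrow> real^'n \<Rightarrow> real^'n" where
  "correlation A f u = transpose A *v (f - A *v u)"

definition gram :: "real^'n^'m \<Rightarrow> real^'n \<Rightarrow> real^'n" where
  "gram A d = transpose A *v (A *v d)"

lemma correlation_inner: "correlation A f u \<bullet> x = (f - A *v u) \<bullet> (A *v x)"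
  by (simp add: correlation_def dot_lmul_matrix)

lemma gram_inner: "gram A d \<bullet> x = (A *v d) \<bullet> (A *v x)"
  by (simp add: gram_def dot_lmul_matrix)

lemma correlation_add: "correlation A f (u + v) = correlation A f u - gram A v"
  unfolding correlation_def gram_def
  by (simp only: matrix_vector_right_distrib matrix_vector_mult_diff_distrib)
    (simp add: algebra_simps)

lemma gram_scaleR: "gram A (c *\<^sub>R d) = c *\<^sub>R gram A d"
  unfolding gram_def by (simp only: matrix_vector_mult_scaleR)

lemma gram_add: "gram A (d + e) = gram A d + gram A e"
  unfolding gram_def by (simp only: matrix_vector_right_distrib)

lemma correlation_add_scaleR [simp]:
  "correlation A f (u + c *\<^sub>R d) $ i = correlation A f u $ i - c * gram A d $ i"
  by (simp add: correlation_add gram_scaleR)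

lemma column_inner_residual: "column i A \<bullet> (A *v u - f) = - correlation A f u $ i"
proof -
  have "correlation A f u $ i = (f - A *v u) \<bullet> column i A"
    using correlation_inner[of A f u "axis i 1"] by (simp add: inner_axis matrix_vector_mult_basis)
  then show ?thesis by (simp add: inner_commute inner_diff_right)
qed

lemma normal_equation_iff: "transpose A *v (A *v u - f) = 0 \<longleftrightarrow> correlation A f u = 0"
proof -
  have "transpose A *v (A *v u - f) = - correlation A f u"
    unfolding correlation_def by (simp only: matrix_vector_mult_diff_distrib) simp
  then show ?thesis by simp
qed

text \<open>This says that the correlation is t times a subgradient of the l1-norm at u. Written
  without division or case distinction, it is a closed condition in t and u. At t = 0 it reduces to
  the normal equation, which is weaker than membership in U_0.\<close>

definition lasso_kkt :: "real^'n^'m \<Rightarrow> real^'m \<Rightarrow> real \<Rightarrow> real^'n \<Rightarrow> bool" where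
  "lasso_kkt A f t u \<longleftrightarrow>
     (\<forall>i. \<bar>correlation A f u $ i\<bar> \<le> t \<and> u $ i * correlation A f u $ i = t * \<bar>u $ i\<bar>)"

lemma lasso_kkt_inner_le:
  assumes "lasso_kkt A f t u"
  shows "correlation A f u \<bullet> v \<le> t * l1_norm v"
proof -
  have "correlation A f u $ i * v $ i \<le> t * \<bar>v $ i\<bar>" for i
    using assms mult_right_mono[of "\<bar>correlation A f u $ i\<bar>" t "\<bar>v $ i\<bar>"]
    by (auto simp: lasso_kkt_def abs_mult intro: order_trans[OF abs_ge_self])
  then show ?thesis
    by (auto simp: inner_vec_def l1_norm_def sum_distrib_left intro: sum_mono)
qed

lemma lasso_kkt_inner_eq:
  assumes "lasso_kkt A f t u"
  shows "correlation A f u \<bullet> u = t * l1_norm u"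
  using assms by (simp add: lasso_kkt_def inner_vec_def l1_norm_def sum_distrib_left mult.commute)

lemma lasso_objective_diff:
  "1/2 * (norm (A *v (u + w) - f))\<^sup>2 =
   1/2 * (norm (A *v u - f))\<^sup>2 - correlation A f u \<bullet> w + 1/2 * (norm (A *v w))\<^sup>2"
  unfolding correlation_inner
  by (simp add: power2_norm_eq_inner matrix_vector_right_distrib inner_diff_left
      inner_diff_right inner_add_left inner_add_right inner_commute)

text \<open>Necessity follows from perturbing one coordinate at a time. Sufficiency is convexity:
  the objective is expanded around u and the linear term is bounded by t times the difference of the
  l1-norms.\<close>

lemma lasso_solution_iff_kkt:
  fixes A :: "real^'n^'m"
  assumes "t > 0"
  shows "u \<in> lasso_solutions A f t \<longleftrightarrow> lasso_kkt A f t u"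
proof
  assume "u \<in> lasso_solutions A f t"
  then have min: "0 \<le> 1/2 * (norm (A *v w))\<^sup>2 - correlation A f u \<bullet> w
                      + t * (l1_norm (u + w) - l1_norm u)" for w
    using assms lasso_objective_diff[of A u w f]
    by (auto simp: lasso_solutions_def is_arg_min_linorder algebra_simps dest!: spec[of _ "u + w"])
  have l1: "l1_norm (u + axis i c) - l1_norm u = \<bar>u $ i + c\<bar> - \<bar>u $ i\<bar>" for i c
  proof -
    have "l1_norm (u + axis i c) - l1_norm u = (\<Sum>k\<in>UNIV. \<bar>u $ k + axis i c $ k\<bar> - \<bar>u $ k\<bar>)"
      by (simp add: l1_norm_def sum_subtractf)
    also have "\<dots> = (\<Sum>k\<in>UNIV. if k = i then \<bar>u $ i + c\<bar> - \<bar>u $ i\<bar> else 0)"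
      by (intro sum.cong) (auto simp: axis_def)
    finally show ?thesis by simp
  qed
  have coord: "0 \<le> \<theta>\<^sup>2 * (1/2 * (norm (A *v axis i c))\<^sup>2) +
      (- \<theta> * c * correlation A f u $ i + t * (\<bar>u $ i + \<theta> * c\<bar> - \<bar>u $ i\<bar>))" for i c \<theta>
  proof -
    have "axis i (\<theta> * c) = \<theta> *\<^sub>R axis i c"
      by (simp add: axis_def vec_eq_iff)
    then have "A *v axis i (\<theta> * c) = \<theta> *\<^sub>R (A *v axis i c)"
      by (simp add: matrix_vector_mult_scaleR)
    then show ?thesis
      using min[of "axis i (\<theta> * c)"] by (simp add: l1 inner_axis power_mult_distrib mult.commute)
  qed
  show "lasso_kkt A f t u"
    unfolding lasso_kkt_def
  proof
    fix i
    let ?q = "correlation A f u $ i"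
    \<comment> \<open>Moving in an arbitrary coordinate direction: c = 1 and c = -1 give the bound
      on the correlation, and c = \<open>u $ i\<close> gives one half of the sign equation.\<close>
    have up: "0 \<le> - c * ?q + t * \<bar>c\<bar>" for c
    proof (rule small_perturbation_nonneg)
      fix \<theta> :: real assume "0 < \<theta>" "\<theta> \<le> 1"
      have "\<bar>u $ i + \<theta> * c\<bar> - \<bar>u $ i\<bar> \<le> \<theta> * \<bar>c\<bar>"
        using \<open>0 < \<theta>\<close> abs_triangle_ineq[of "u $ i" "\<theta> * c"] by (simp add: abs_mult)
      then have "t * (\<bar>u $ i + \<theta> * c\<bar> - \<bar>u $ i\<bar>) \<le> t * (\<theta> * \<bar>c\<bar>)"
        using assms by (intro mult_left_mono) auto
      then show "0 \<le> \<theta>\<^sup>2 * (1/2 * (norm (A *v axis i c))\<^sup>2) + \<theta> * (- c * ?q + t * \<bar>c\<bar>)"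
        using coord[of \<theta> i c] by (simp add: algebra_simps)
    qed
    \<comment> \<open>Shrinking the coordinate towards 0 decreases its absolute value linearly,
      which gives the other half.\<close>
    have "0 \<le> u $ i * ?q - t * \<bar>u $ i\<bar>"
    proof (rule small_perturbation_nonneg)
      fix \<theta> :: real assume \<theta>: "0 < \<theta>" "\<theta> \<le> 1"
      have "u $ i + \<theta> * (- u $ i) = (1 - \<theta>) * u $ i"
        by (simp add: algebra_simps)
      then have eq: "\<bar>u $ i + \<theta> * (- u $ i)\<bar> - \<bar>u $ i\<bar> = - \<theta> * \<bar>u $ i\<bar>"
        using \<theta> abs_mult[of "1 - \<theta>" "u $ i"] by (simp only: abs_of_nonneg)
      show "0 \<le> \<theta>\<^sup>2 * (1/2 * (norm (A *v axis i (- u $ i)))\<^sup>2) + \<theta> * (u $ i * ?q - t * \<bar>u $ i\<bar>)"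
        using coord[of \<theta> i "- u $ i", unfolded eq] by (simp add: algebra_simps)
    qed
    with up[of 1] up[of "-1"] up[of "u $ i"]
    show "\<bar>?q\<bar> \<le> t \<and> u $ i * ?q = t * \<bar>u $ i\<bar>"
      by auto
  qed
next
  assume kkt: "lasso_kkt A f t u"
  have "1/2 * (norm (A *v u - f))\<^sup>2 + t * l1_norm u \<le> 1/2 * (norm (A *v v - f))\<^sup>2 + t * l1_norm v"
    for v
  proof -
    have "1/2 * (norm (A *v v - f))\<^sup>2 = 1/2 * (norm (A *v u - f))\<^sup>2
        - (correlation A f u \<bullet> v - correlation A f u \<bullet> u) + 1/2 * (norm (A *v (v - u)))\<^sup>2"
      using lasso_objective_diff[of A u "v - u" f]
        by (simp only: inner_diff_right diff_add_cancel add.commute[of u])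
    moreover have "0 \<le> (norm (A *v (v - u)))\<^sup>2" by simp
    ultimately show ?thesis
      using lasso_kkt_inner_le[OF kkt, of v] lasso_kkt_inner_eq[OF kkt] by linarith
  qed
  then show "u \<in> lasso_solutions A f t"
    using assms by (simp add: lasso_solutions_def is_arg_min_linorder)
qed

text \<open>Monotonicity of the subdifferential gives that the squared norm of A(v - u), which is
  (q(u) - q(v)) \<bullet> (v - u), is at most 0. Hence Au = Av, although u and v may differ.\<close>

lemma lasso_kkt_correlation_unique:
  assumes "lasso_kkt A f t u" "lasso_kkt A f t v"
  shows "correlation A f u = correlation A f v"
proof -
  have v: "v = u + (v - u)" by simp
  have "correlation A f v = correlation A f u - gram A (v - u)"
    by (subst v) (simp only: correlation_add)
  then have "(norm (A *v (v - u)))\<^sup>2 = (correlation A f u - correlation A f v) \<bullet> (v - u)"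
    by (simp add: gram_inner power2_norm_eq_inner)
  also have "\<dots> \<le> 0"
    using lasso_kkt_inner_le[OF assms(1), of v] lasso_kkt_inner_le[OF assms(2), of u]
      lasso_kkt_inner_eq[OF assms(1)] lasso_kkt_inner_eq[OF assms(2)]
    by (simp add: inner_diff_left inner_diff_right)
  finally have "A *v u = A *v v"
    by (simp add: matrix_vector_mult_diff_distrib)
  then show ?thesis by (simp add: correlation_def)
qed

lemma lasso_solution_zero:
  assumes "correlation A f u = 0" "\<And>v. correlation A f v = 0 \<Longrightarrow> l1_norm u \<le> l1_norm v"
  shows "u \<in> lasso_solutions A f 0"
  using assms by (auto simp: lasso_solutions_def is_arg_min_linorder normal_equation_iff
      simp del: transpose_matrix_vector)

text \<open>For c > 0 the optimality conditions pass to the limit because they are closed. For c = 0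
  they give only the normal equation, and minimality of the l1-norm needs a separate
  comparison.\<close>

lemma lasso_solution_limit:
  fixes A :: "real^'n^'m"
  assumes "0 \<le> c" "c < t"
    and sol: "\<And>\<tau>. \<tau> \<in> {c<..t} \<Longrightarrow> u + (t - \<tau>) *\<^sub>R d \<in> lasso_solutions A f \<tau>"
  shows "u + (t - c) *\<^sub>R d \<in> lasso_solutions A f c"
proof -
  define w where "w \<tau> = u + (t - \<tau>) *\<^sub>R d" for \<tau>
  have kkt: "lasso_kkt A f \<tau> (w \<tau>)" if "\<tau> \<in> {c<..t}" for \<tau>
    using sol[OF that] that assms(1) by (auto simp: w_def lasso_solution_iff_kkt)
  have limit: "c \<in> S" if "closed S" "{c<..t} \<subseteq> S" for S
  proof -
    have "closure {c<..t} \<subseteq> S" using that by (metis closure_minimal)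
    then show ?thesis using assms(2) by auto
  qed
  have "c \<in> {\<tau>. lasso_kkt A f \<tau> (w \<tau>)}"
  proof (rule limit)
    show "closed {\<tau>. lasso_kkt A f \<tau> (w \<tau>)}"
      unfolding lasso_kkt_def w_def correlation_add_scaleR vector_add_component vector_scaleR_component
      by (intro closed_Collect_all closed_Collect_conj closed_Collect_le closed_Collect_eq
          continuous_intros)
  qed (use kkt in auto)
  then have kkt_c: "lasso_kkt A f c (w c)" by simp
  show ?thesis
  proof (cases "c = 0")
    case False
    then show ?thesis
      using kkt_c assms(1) by (simp add: lasso_solution_iff_kkt w_def)
  next
    case True
    have "w 0 \<in> lasso_solutions A f 0"
    proof (rule lasso_solution_zero)
      show "correlation A f (w 0) = 0"
        using kkt_c True by (auto simp: lasso_kkt_def vec_eq_iff)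
    next
      fix v assume v: "correlation A f v = 0"
      have "l1_norm (w \<tau>) \<le> l1_norm v" if "\<tau> \<in> {c<..t}" for \<tau>
      proof -
        have "\<tau> > 0" using that assms(1) by simp
        \<comment> \<open>Since v has the smallest possible residual, optimality of
          \<open>w \<tau>\<close> forces its l1-norm to be no larger than that of v. This bound is
          then passed to the limit.\<close>
        have "1/2 * (norm (A *v v - f))\<^sup>2 \<le> 1/2 * (norm (A *v w \<tau> - f))\<^sup>2"
          using lasso_objective_diff[of A v "w \<tau> - v" f] v by simp
        moreover have "1/2 * (norm (A *v w \<tau> - f))\<^sup>2 + \<tau> * l1_norm (w \<tau>)
            \<le> 1/2 * (norm (A *v v - f))\<^sup>2 + \<tau> * l1_norm v"
          using sol[OF that] \<open>\<tau> > 0\<close> by (auto simp: w_def lasso_solutions_def is_arg_min_linorder)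
        ultimately have "\<tau> * l1_norm (w \<tau>) \<le> \<tau> * l1_norm v" by linarith
        then show ?thesis using \<open>\<tau> > 0\<close> by simp
      qed
      moreover have "closed {\<tau>. l1_norm (w \<tau>) \<le> l1_norm v}"
        unfolding l1_norm_def w_def vector_add_component vector_scaleR_component
        by (intro closed_Collect_le continuous_intros)
      ultimately have "c \<in> {\<tau>. l1_norm (w \<tau>) \<le> l1_norm v}"
        by (intro limit) auto
      then show "l1_norm (w 0) \<le> l1_norm v" using True by simp
    qed
    then show ?thesis by (simp add: True w_def)
  qed
qed

section \<open>Directions\<close>

text \<open>The constraint set of step (3), with the sign condition on the correlation in place of
  p; for t > 0 these differ by a positive factor.\<close>

definition admissible_directions :: "real^'n^'m \<Rightarrow> real^'m \<Rightarrow> real \<Rightarrow> real^'n \<Rightarrow> (real^'n) set" where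
  "admissible_directions A f t u =
     {d. \<forall>i. (\<bar>correlation A f u $ i\<bar> \<noteq> t \<longrightarrow> d $ i = 0) \<and>
             (\<bar>correlation A f u $ i\<bar> = t \<longrightarrow> u $ i = 0 \<longrightarrow> 0 \<le> d $ i * correlation A f u $ i)}"

lemma convex_cone_admissible_directions: "convex_cone (admissible_directions A f t u)"
  by (auto simp: convex_cone_iff admissible_directions_def distrib_right mult.assoc
      intro!: exI[of _ 0] add_nonneg_nonneg mult_nonneg_nonneg)

lemma convex_admissible_directions: "convex (admissible_directions A f t u)"
  using convex_cone_admissible_directions by (auto simp: convex_cone_def)

lemma direction_set_alt:
  assumes "t > 0"
  shows "direction_set A f t u =
     {d. is_arg_min (\<lambda>d. (norm (A *v d - (1 / t) *\<^sub>R (f - A *v u)))\<^sup>2)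
           (\<lambda>d. d \<in> admissible_directions A f t u) d}"
proof -
  have "(\<lambda>d. (\<forall>i. i \<notin> equicorrelation_set A f t u \<longrightarrow> d $ i = 0) \<and>
      (\<forall>i\<in>equicorrelation_set A f t u - active_set u.
         0 \<le> d $ i * ((1 / t) *\<^sub>R (transpose A *v (f - A *v u))) $ i)) =
      (\<lambda>d. d \<in> admissible_directions A f t u)"
    using assms
    by (auto simp: fun_eq_iff equicorrelation_set_def column_inner_residual active_set_def
        admissible_directions_def zero_le_divide_iff correlation_def[symmetric]
        simp del: transpose_matrix_vector)
  then show ?thesis
    by (simp only: direction_set_def Let_def)
qed

lemma direction_set_iff:
  assumes "t > 0"
  shows "d \<in> direction_set A f t u \<longleftrightarrow> d \<in> admissible_directions A f t u \<and>
     (\<forall>x\<in>admissible_directions A f t u. 0 \<le> (gram A d - (1 / t) *\<^sub>R correlation A f u) \<bullet> (x - d))"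
proof -
  have "(A *v d - (1 / t) *\<^sub>R (f - A *v u)) \<bullet> (A *v (x - d)) =
      (gram A d - (1 / t) *\<^sub>R correlation A f u) \<bullet> (x - d)" for x
    by (simp only: inner_diff_left inner_scaleR_left gram_inner correlation_inner)
  then show ?thesis
    unfolding direction_set_alt[OF assms] mem_Collect_eq
    by (subst least_squares_arg_min_iff)
      (auto simp: matrix_vector_mul_linear convex_admissible_directions)
qed

text \<open>Adding the variational inequalities of two minimizers shows that they have the same
  image under A. The set of minimizers is therefore an affine slice of the admissible cone, which
  makes it convex and closed.\<close>

lemma direction_set_eq:
  assumes "t > 0" and d: "d \<in> direction_set A f t u"
  shows "direction_set A f t u = admissible_directions A f t u \<inter> {e. A *v e = A *v d}"
proof (intro set_eqI iffI)
  fix e assume "e \<in> direction_set A f t u"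
  then have e: "e \<in> admissible_directions A f t u"
    and "0 \<le> (gram A d - (1 / t) *\<^sub>R correlation A f u) \<bullet> (e - d)"
    and "0 \<le> (gram A e - (1 / t) *\<^sub>R correlation A f u) \<bullet> (d - e)"
    using d by (auto simp: direction_set_iff[OF assms(1)])
  then have "(gram A e - gram A d) \<bullet> (e - d) \<le> 0"
    by (simp add: inner_diff_left inner_diff_right)
  moreover have "(gram A e - gram A d) \<bullet> (e - d) = (norm (A *v (e - d)))\<^sup>2"
    by (simp add: inner_diff_left gram_inner power2_norm_eq_inner matrix_vector_mult_diff_distrib)
  ultimately show "e \<in> admissible_directions A f t u \<inter> {e. A *v e = A *v d}"
    using e by (simp add: matrix_vector_mult_diff_distrib)
next
  fix e assume "e \<in> admissible_directions A f t u \<inter> {e. A *v e = A *v d}"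
  then show "e \<in> direction_set A f t u"
    using d by (auto simp: direction_set_alt[OF assms(1)] is_arg_min_linorder)
qed

text \<open>Admissible directions vanish off the equicorrelation set and the gradient vanishes on
  it, so the variational inequality holds with equality. This certifies convex combinations of old
  and new directions later.\<close>

lemma direction_setI:
  assumes "t > 0" "d \<in> admissible_directions A f t u"
    and "\<And>i. \<bar>correlation A f u $ i\<bar> = t \<Longrightarrow> t * gram A d $ i = correlation A f u $ i"
  shows "d \<in> direction_set A f t u"
proof -
  have "(gram A d - (1 / t) *\<^sub>R correlation A f u) \<bullet> (x - d) = 0"
    if "x \<in> admissible_directions A f t u" for x
    unfolding inner_vec_def
  proof (intro sum.neutral ballI)
    fix i
    show "(gram A d - (1 / t) *\<^sub>R correlation A f u) $ i \<bullet> (x - d) $ i = 0"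
      using assms(1,2) assms(3)[of i] that
      by (cases "\<bar>correlation A f u $ i\<bar> = t") (auto simp: admissible_directions_def field_simps)
  qed
  then show ?thesis using assms(1,2) by (simp add: direction_set_iff)
qed

lemma convex_direction_set:
  assumes "t > 0"
  shows "convex (direction_set A f t u)"
proof (cases "direction_set A f t u = {}")
  case False
  then obtain d where d: "d \<in> direction_set A f t u" by blast
  have "convex {e. A *v e = A *v d}"
    by (rule convexI) (auto simp: matrix_vector_right_distrib matrix_vector_mult_scaleR
        simp flip: scaleR_add_left)
  then show ?thesis
    unfolding direction_set_eq[OF assms d] by (intro convex_Int convex_admissible_directions)
qed simp

lemma closed_direction_set:
  assumes "t > 0"
  shows "closed (direction_set A f t u)"
proof (cases "direction_set A f t u = {}")
  case False
  then obtain d where d: "d \<in> direction_set A f t u" by blast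
  have "closed {e. A *v e = A *v d}"
    by (intro closed_Collect_eq continuous_intros)
  moreover have "closed (admissible_directions A f t u)"
    unfolding admissible_directions_def
    by (intro closed_Collect_all closed_Collect_conj closed_Collect_imp open_Collect_const
        closed_Collect_eq closed_Collect_le continuous_intros)
  ultimately show ?thesis
    unfolding direction_set_eq[OF assms d] by (intro closed_Int)
qed simp

text \<open>Two projections are taken: of the scaled residual onto the closed image of the
  admissible cone, which gives a least-squares minimizer, and then of the origin onto the closed set
  of all such minimizers.\<close>

lemma min_norm_direction_exists:
  fixes A :: "real^'n^'m"
  assumes "t > 0"
  obtains d where "is_arg_min norm (\<lambda>d. d \<in> direction_set A f t u) d"
proof -
  let ?F = "admissible_directions A f t u" and ?b = "(1 / t) *\<^sub>R (f - A *v u)"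
  have "closed ((*v) A ` ?F)"
  proof (rule closed_linear_image_convex_cone)
    fix d i assume "d \<in> ?F"
    then show "axis i (sgn (d $ i)) \<in> ?F"
      by (auto simp: admissible_directions_def axis_def sgn_if zero_le_mult_iff)
  qed (simp_all add: convex_cone_admissible_directions matrix_vector_mul_linear)
  moreover have "(*v) A ` ?F \<noteq> {}"
    using convex_cone_nonempty[OF convex_cone_admissible_directions] by blast
  ultimately obtain y where y: "y \<in> (*v) A ` ?F" "\<And>z. z \<in> (*v) A ` ?F \<Longrightarrow> dist ?b y \<le> dist ?b z"
    using distance_attains_inf by blast
  then have "direction_set A f t u \<noteq> {}"
    by (force simp: direction_set_alt[OF assms] is_arg_min_linorder dist_norm norm_minus_commute
        power_mono_iff)
  then obtain d where "d \<in> direction_set A f t u"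
      "\<And>e. e \<in> direction_set A f t u \<Longrightarrow> dist 0 d \<le> dist 0 e"
    using distance_attains_inf[OF closed_direction_set[OF assms]] by blast
  then show thesis by (intro that) (auto simp: is_arg_min_linorder)
qed

text \<open>These are complementary slackness, stationarity on active coordinates, and the sign of
  the multiplier. They come from varying d in coordinate i by c = d_i and -d_i, by 1 and -1, and by
  the correlation itself, respectively.\<close>

lemma direction_optimality:
  assumes "t > 0" and d: "d \<in> direction_set A f t u" and i: "\<bar>correlation A f u $ i\<bar> = t"
  shows "d $ i * (t * gram A d $ i - correlation A f u $ i) = 0"
    and "u $ i \<noteq> 0 \<Longrightarrow> t * gram A d $ i = correlation A f u $ i"
    and "0 \<le> correlation A f u $ i * (t * gram A d $ i - correlation A f u $ i)"
proof -
  have adm: "d \<in> admissible_directions A f t u"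
    using assms by (simp add: direction_set_iff)
  have var: "0 \<le> c * (t * gram A d $ i - correlation A f u $ i)"
    if "u $ i = 0 \<Longrightarrow> 0 \<le> (d $ i + c) * correlation A f u $ i" for c
  proof -
    have "d + axis i c \<in> admissible_directions A f t u"
      using adm i that by (auto simp: admissible_directions_def axis_def)
    then have "0 \<le> (gram A d - (1 / t) *\<^sub>R correlation A f u) \<bullet> (d + axis i c - d)"
      using assms by (auto simp: direction_set_iff)
    then have "0 \<le> t * ((gram A d $ i - correlation A f u $ i / t) * c)"
      using assms(1) by (simp add: inner_axis)
    also have "\<dots> = c * (t * gram A d $ i - correlation A f u $ i)"
      using assms(1) by (simp add: field_simps)
    finally show ?thesis .
  qed
  have sgn: "u $ i = 0 \<Longrightarrow> 0 \<le> d $ i * correlation A f u $ i"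
    using adm i by (simp add: admissible_directions_def)
  show "d $ i * (t * gram A d $ i - correlation A f u $ i) = 0"
    using var[of "d $ i"] var[of "- d $ i"] sgn by (simp add: distrib_right)
  show "t * gram A d $ i = correlation A f u $ i" if "u $ i \<noteq> 0"
    using var[of 1] var[of "-1"] that by simp
  show "0 \<le> correlation A f u $ i * (t * gram A d $ i - correlation A f u $ i)"
    using var[of "correlation A f u $ i"] sgn by (simp add: distrib_right)
qed

text \<open>One coordinate of the optimality conditions, with q the correlation, g the Gram image of
  the direction, v the solution and d the direction. If \<bar>q\<bar> < t, then v = d = 0 and the
  strict bound persists by continuity. If \<bar>q\<bar> = t and t * g = q, the correlation scales
  exactly with \<tau>. Otherwise v = d = 0 and the correlation retreats from the bound at least as
  fast as \<tau> falls.\<close>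

lemma kkt_coordinate_eventually:
  fixes q g v d t :: real
  assumes "t > 0" "\<bar>q\<bar> \<le> t" "v * q = t * \<bar>v\<bar>"
    and "\<bar>q\<bar> \<noteq> t \<Longrightarrow> d = 0"
    and "\<bar>q\<bar> = t \<Longrightarrow> v \<noteq> 0 \<Longrightarrow> t * g = q"
    and "\<bar>q\<bar> = t \<Longrightarrow> v = 0 \<Longrightarrow> 0 \<le> d * q"
    and "\<bar>q\<bar> = t \<Longrightarrow> 0 \<le> q * (t * g - q)"
    and "\<bar>q\<bar> = t \<Longrightarrow> d * (t * g - q) = 0"
  shows "\<forall>\<^sub>F \<tau> in at_left t. \<bar>q - (t - \<tau>) * g\<bar> \<le> \<tau> \<and>
           (v + (t - \<tau>) * d) * (q - (t - \<tau>) * g) = \<tau> * \<bar>v + (t - \<tau>) * d\<bar>"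
proof -
  have left: "\<forall>\<^sub>F \<tau> in at_left t. \<tau> < t" "\<forall>\<^sub>F \<tau> in at_left t. 0 < \<tau>"
    using assms(1) by (auto simp: eventually_at_left[of 0] intro: exI[of _ 0])
  consider "\<bar>q\<bar> < t" | "\<bar>q\<bar> = t" "t * g = q" | "\<bar>q\<bar> = t" "t * g \<noteq> q"
    using assms(2) by linarith
  then show ?thesis
  proof cases
    case 1
    have "\<bar>v\<bar> * \<bar>q\<bar> = \<bar>v\<bar> * t"
      using assms(1) arg_cong[OF assms(3), of abs] by (simp add: abs_mult)
    then have "v = 0" "d = 0" using 1 assms(4) by auto
    have "((\<lambda>\<tau>. \<tau> - \<bar>q - (t - \<tau>) * g\<bar>) \<longlongrightarrow> t - \<bar>q - (t - t) * g\<bar>) (at_left t)"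
      by (intro tendsto_intros)
    then have "\<forall>\<^sub>F \<tau> in at_left t. 0 < \<tau> - \<bar>q - (t - \<tau>) * g\<bar>"
      using 1 by (intro order_tendstoD) auto
    then show ?thesis
      by eventually_elim (simp add: \<open>v = 0\<close> \<open>d = 0\<close>)
  next
    case 2
    have "\<forall>\<^sub>F \<tau> in at_left t. 0 \<le> (v + (t - \<tau>) * d) * q"
    proof (cases "v = 0")
      case True
      then have "0 \<le> d * q" using 2 assms(6) by simp
      show ?thesis
        using left(1)
      proof eventually_elim
        case (elim \<tau>)
        then have "0 \<le> (t - \<tau>) * (d * q)" using \<open>0 \<le> d * q\<close> by simp
        then show ?case by (simp add: True mult.assoc)
      qed
    next
      case False
      have "((\<lambda>\<tau>. (v + (t - \<tau>) * d) * q) \<longlongrightarrow> (v + (t - t) * d) * q) (at_left t)"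
        by (intro tendsto_intros)
      moreover have "0 < v * q"
        using False assms(1,3) by simp
      ultimately have "\<forall>\<^sub>F \<tau> in at_left t. 0 < (v + (t - \<tau>) * d) * q"
        by (intro order_tendstoD) auto
      then show ?thesis by eventually_elim simp
    qed
    then show ?thesis
      using left(2)
    proof eventually_elim
      case (elim \<tau>)
      have t_q: "t * (q - (t - \<tau>) * g) = \<tau> * q"
        using 2(2) by (simp add: algebra_simps)
      have "t * \<bar>q - (t - \<tau>) * g\<bar> = \<bar>t * (q - (t - \<tau>) * g)\<bar>"
        using assms(1) by (simp add: abs_mult)
      also have "\<dots> = t * \<tau>"
        unfolding t_q using elim(2) 2(1) by (simp add: abs_mult)
      finally have "t * \<bar>q - (t - \<tau>) * g\<bar> = t * \<tau>" .
      moreover have "(v + (t - \<tau>) * d) * q = t * \<bar>v + (t - \<tau>) * d\<bar>"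
        using 2(1) abs_of_nonneg[OF elim(1)] by (simp add: abs_mult mult.commute)
      then have "t * ((v + (t - \<tau>) * d) * (q - (t - \<tau>) * g)) = t * (\<tau> * \<bar>v + (t - \<tau>) * d\<bar>)"
        using t_q by (metis mult.left_commute)
      ultimately show ?case
        using assms(1) by simp
    qed
  next
    case 3
    then have "v = 0" "d = 0" using assms(5,8) by auto
    \<comment> \<open>The limit is 2t > 0. Its positivity keeps the moving correlation from
      overshooting the bound of opposite sign.\<close>
    have lim: "((\<lambda>\<tau>. \<tau> + \<bar>q\<bar> - \<bar>(t - \<tau>) * g\<bar>) \<longlongrightarrow> t + \<bar>q\<bar> - \<bar>(t - t) * g\<bar>) (at_left t)"
      by (intro tendsto_intros)
    have "\<forall>\<^sub>F \<tau> in at_left t. 0 < \<tau> + \<bar>q\<bar> - \<bar>(t - \<tau>) * g\<bar>"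
      by (rule order_tendstoD(1)[OF lim]) (use assms(1) in simp)
    then show ?thesis
      using left(1)
    proof eventually_elim
      case (elim \<tau>)
      define x where "x = (t - \<tau>) * g"
      have x: "0 < \<tau> + \<bar>q\<bar> - \<bar>x\<bar>"
        using elim(1) by (simp add: x_def)
      consider "q = t" | "q = - t" using 3(1) by linarith
      then have "\<bar>q - x\<bar> \<le> \<tau>"
      proof cases
        case 1
        then have "1 \<le> g"
          using assms(1,7) 3(1) by (auto simp: zero_le_mult_iff)
        then have "(t - \<tau>) * 1 \<le> x"
          unfolding x_def using elim(2) by (intro mult_left_mono) auto
        then have "t - \<tau> \<le> x" by simp
        moreover have "x < \<tau> + t"
          using x 3(1) by linarith
        ultimately show ?thesis
          unfolding 1 abs_le_iff by (intro conjI) linarith+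
      next
        case 2
        then have "t * g \<le> t * (-1)"
          using assms(1,7) 3(1) by (auto simp: zero_le_mult_iff mult_le_0_iff)
        then have "g \<le> -1" using assms(1) by (simp only: mult_le_cancel_left_pos)
        then have "x \<le> (t - \<tau>) * (-1)"
          unfolding x_def using elim(2) by (intro mult_left_mono) auto
        then have "x \<le> \<tau> - t" by simp
        moreover have "- x < \<tau> + t"
          using x 3(1) by linarith
        ultimately show ?thesis
          unfolding 2 abs_le_iff by (intro conjI) linarith+
      qed
      then show ?case by (simp add: \<open>v = 0\<close> \<open>d = 0\<close> x_def)
    qed
  qed
qed

lemma direction_eventually_solution:
  fixes A :: "real^'n^'m"
  assumes "t > 0" "u \<in> lasso_solutions A f t" "d \<in> direction_set A f t u"
  shows "\<forall>\<^sub>F \<tau> in at_left t. u + (t - \<tau>) *\<^sub>R d \<in> lasso_solutions A f \<tau>"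
proof -
  have kkt: "lasso_kkt A f t u"
    using assms by (simp add: lasso_solution_iff_kkt)
  have adm: "d \<in> admissible_directions A f t u"
    using assms by (simp add: direction_set_iff)
  have "\<forall>\<^sub>F \<tau> in at_left t. \<forall>i. \<bar>correlation A f u $ i - (t - \<tau>) * gram A d $ i\<bar> \<le> \<tau> \<and>
      (u $ i + (t - \<tau>) * d $ i) * (correlation A f u $ i - (t - \<tau>) * gram A d $ i) =
      \<tau> * \<bar>u $ i + (t - \<tau>) * d $ i\<bar>"
    using kkt adm direction_optimality[OF assms(1,3)] assms(1)
    by (intro eventually_all_finite kkt_coordinate_eventually)
      (auto simp: lasso_kkt_def admissible_directions_def)
  moreover have "\<forall>\<^sub>F \<tau> in at_left t. 0 < \<tau>"
    using assms(1) by (auto simp: eventually_at_left[of 0] intro: exI[of _ 0])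
  ultimately show ?thesis
    by eventually_elim (simp add: lasso_solution_iff_kkt lasso_kkt_def)
qed

section \<open>Homotopy steps\<close>

text \<open>The candidate is the infimum of the valid endpoints. Every parameter strictly above it
  yields a solution, and the limit lemma, including its case of parameter 0, shows that the infimum
  is attained.\<close>

lemma homotopy_step_exists:
  fixes A :: "real^'n^'m"
  assumes "t > 0" "u \<in> lasso_solutions A f t"
  shows "\<exists>t' u'. homotopy_step A f t u t' u'"
proof -
  obtain d where d: "is_arg_min norm (\<lambda>d. d \<in> direction_set A f t u) d"
    using min_norm_direction_exists[OF assms(1)] .
  define S where "S = {s \<in> {0..t}. \<forall>\<tau>\<in>{s..t}. u + (t - \<tau>) *\<^sub>R d \<in> lasso_solutions A f \<tau>}"
  have "t \<in> S" using assms by (auto simp: S_def)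
  have bdd: "bdd_below S" by (rule bdd_belowI[of _ 0]) (auto simp: S_def)
  define t' where "t' = Inf S"
  have lower: "t' \<le> s" if "s \<in> S" for s
    unfolding t'_def using that bdd by (rule cInf_lower)
  have "0 \<le> t'"
    unfolding t'_def using \<open>t \<in> S\<close> by (intro cInf_greatest) (auto simp: S_def)
  have above: "u + (t - \<tau>) *\<^sub>R d \<in> lasso_solutions A f \<tau>" if "\<tau> \<in> {t'<..t}" for \<tau>
  proof -
    have "\<exists>s\<in>S. s < \<tau>"
      using that \<open>t \<in> S\<close> bdd cInf_less_iff[of S \<tau>] by (auto simp: t'_def)
    then show ?thesis using that by (auto simp: S_def)
  qed
  have "u + (t - t') *\<^sub>R d \<in> lasso_solutions A f t'"
  proof (cases "t' = t")
    case False
    then show ?thesis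
      by (intro lasso_solution_limit[OF \<open>0 \<le> t'\<close> _ above]) (use lower[OF \<open>t \<in> S\<close>] in auto)
  qed (use assms in simp)
  then have "u + (t - \<tau>) *\<^sub>R d \<in> lasso_solutions A f \<tau>" if "\<tau> \<in> {t'..t}" for \<tau>
    using above that by (cases "\<tau> = t'") auto
  then have "t' \<in> S"
    using \<open>0 \<le> t'\<close> lower[OF \<open>t \<in> S\<close>] by (auto simp: S_def)
  then have "homotopy_step A f t u t' (u + (t - t') *\<^sub>R d)"
    unfolding homotopy_step_def Let_def
    using assms(1) d lower by (intro conjI exI[of _ d] ballI) (auto simp: S_def)
  then show ?thesis by blast
qed

lemma homotopy_step_unique:
  assumes "t > 0" "homotopy_step A f t u t1 u1" "homotopy_step A f t u t2 u2"
  shows "t1 = t2 \<and> u1 = u2"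
proof -
  define S where "S d = {s \<in> {0..t}. \<forall>\<tau>\<in>{s..t}. u + (t - \<tau>) *\<^sub>R d \<in> lasso_solutions A f \<tau>}" for d
  obtain d1 where d1: "is_arg_min norm (\<lambda>d. d \<in> direction_set A f t u) d1"
      "t1 \<in> S d1" "\<forall>s\<in>S d1. t1 \<le> s" "u1 = u + (t - t1) *\<^sub>R d1"
    using assms(2) by (auto simp: homotopy_step_def S_def Let_def)
  obtain d2 where d2: "is_arg_min norm (\<lambda>d. d \<in> direction_set A f t u) d2"
      "t2 \<in> S d2" "\<forall>s\<in>S d2. t2 \<le> s" "u2 = u + (t - t2) *\<^sub>R d2"
    using assms(3) by (auto simp: homotopy_step_def S_def Let_def)
  have "d1 = d2"
    using min_norm_unique[OF convex_direction_set[OF assms(1)] d1(1) d2(1)] .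
  then show ?thesis
    using d1 d2 by (auto intro: order_antisym)
qed

text \<open>A step with its direction made explicit. Minimality of t' is recast as a blocking
  condition: immediately below a positive t', the same direction no longer yields solutions
  throughout. This form is used to compare consecutive directions.\<close>

definition homotopy_direction ::
    "real^'n^'m \<Rightarrow> real^'m \<Rightarrow> real \<Rightarrow> real^'n \<Rightarrow> real \<Rightarrow> real^'n \<Rightarrow> real^'n \<Rightarrow> bool" where
  "homotopy_direction A f t u t' u' d \<longleftrightarrow>
     is_arg_min norm (\<lambda>d. d \<in> direction_set A f t u) d \<and> 0 \<le> t' \<and> t' < t \<and>
     u' = u + (t - t') *\<^sub>R d \<and>
     (\<forall>\<tau>\<in>{t'..t}. u + (t - \<tau>) *\<^sub>R d \<in> lasso_solutions A f \<tau>) \<and>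
     (0 < t' \<longrightarrow> \<not> (\<forall>\<^sub>F \<tau> in at_left t'. u' + (t' - \<tau>) *\<^sub>R d \<in> lasso_solutions A f \<tau>))"

lemma homotopy_step_direction:
  fixes A :: "real^'n^'m"
  assumes step: "homotopy_step A f t u t' u'" and "t > 0" "u \<in> lasso_solutions A f t"
  shows "\<exists>d. homotopy_direction A f t u t' u' d"
proof -
  define S where "S d = {s \<in> {0..t}. \<forall>\<tau>\<in>{s..t}. u + (t - \<tau>) *\<^sub>R d \<in> lasso_solutions A f \<tau>}" for d
  obtain d where d: "is_arg_min norm (\<lambda>d. d \<in> direction_set A f t u) d"
      "t' \<in> S d" "\<And>s. s \<in> S d \<Longrightarrow> t' \<le> s" "u' = u + (t - t') *\<^sub>R d"
    using step by (auto simp: homotopy_step_def S_def Let_def)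
  \<comment> \<open>Used twice: with t' = t it excludes a step of length zero, and for positive t'
    it gives the blocking condition.\<close>
  have maximal: False
    if pos: "0 < t'" and ev: "\<forall>\<^sub>F \<tau> in at_left t'. u + (t - \<tau>) *\<^sub>R d \<in> lasso_solutions A f \<tau>"
  proof -
    obtain b where b: "b < t'" "\<And>\<tau>. b < \<tau> \<Longrightarrow> \<tau> < t' \<Longrightarrow> u + (t - \<tau>) *\<^sub>R d \<in> lasso_solutions A f \<tau>"
      using ev unfolding eventually_at_left[OF pos] by blast
    \<comment> \<open>The midpoint lies above b and is nonnegative, so it is a valid endpoint
      smaller than t'.\<close>
    define s where "s = (max b 0 + t') / 2"
    have s: "b < s" "0 \<le> s" "s < t'"
      using b(1) pos by (auto simp: s_def max_def)
    have "u + (t - \<tau>) *\<^sub>R d \<in> lasso_solutions A f \<tau>" if "\<tau> \<in> {s..t}" for \<tau>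
      using that s b(2)[of \<tau>] d(2) by (cases "\<tau> < t'") (auto simp: S_def)
    then have "s \<in> S d"
      using s d(2) by (auto simp: S_def)
    then show False using d(3) s by fastforce
  qed
  have "d \<in> direction_set A f t u"
    using d(1) by (simp add: is_arg_min_linorder)
  then have "\<forall>\<^sub>F \<tau> in at_left t. u + (t - \<tau>) *\<^sub>R d \<in> lasso_solutions A f \<tau>"
    using assms by (intro direction_eventually_solution)
  then have "t' \<noteq> t" using maximal assms(2) by auto
  have "u' + (t' - \<tau>) *\<^sub>R d = u + (t - \<tau>) *\<^sub>R d" for \<tau>
    by (simp add: d(4) add.assoc flip: scaleR_add_left)
  then have "\<not> (\<forall>\<^sub>F \<tau> in at_left t'. u' + (t' - \<tau>) *\<^sub>R d \<in> lasso_solutions A f \<tau>)"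
    if "0 < t'"
    using maximal that by auto
  then have "homotopy_direction A f t u t' u' d"
    using d(1,2,4) \<open>t' \<noteq> t\<close> by (auto simp: S_def homotopy_direction_def)
  then show ?thesis by blast
qed

section \<open>Sign patterns do not recur\<close>

text \<open>Finitely many values are possible. For a solution at t > 0, the last two sets also
  determine the signs of the active coordinates.\<close>

definition sign_pattern ::
    "real^'n^'m \<Rightarrow> real^'m \<Rightarrow> real \<Rightarrow> real^'n \<Rightarrow> 'n set \<times> 'n set \<times> 'n set" where
  "sign_pattern A f t u =
     (active_set u, {i. correlation A f u $ i = t}, {i. correlation A f u $ i = - t})"

text \<open>The active set is left out because between two equal patterns only the correlation signs
  are shown to be constant.\<close>

definition same_signs :: "real^'n^'m \<Rightarrow> real^'m \<Rightarrow> real \<Rightarrow> real^'n \<Rightarrow> real \<Rightarrow> real^'n \<Rightarrow> bool" where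
  "same_signs A f t u t' u' \<longleftrightarrow>
     (\<forall>i. (correlation A f u $ i = t \<longleftrightarrow> correlation A f u' $ i = t') \<and>
          (correlation A f u $ i = - t \<longleftrightarrow> correlation A f u' $ i = - t'))"

lemma sign_pattern_eq_iff:
  "sign_pattern A f t u = sign_pattern A f t' u' \<longleftrightarrow>
     active_set u = active_set u' \<and> same_signs A f t u t' u'"
  by (auto simp: sign_pattern_def same_signs_def set_eq_iff)

lemma same_signs_equicorrelation:
  assumes "same_signs A f t u t' u'" "t > 0" "t' > 0"
  shows "\<bar>correlation A f u $ i\<bar> = t \<longleftrightarrow> \<bar>correlation A f u' $ i\<bar> = t'"
    and "\<bar>correlation A f u $ i\<bar> = t \<Longrightarrow> correlation A f u $ i / t = correlation A f u' $ i / t'"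
    and "\<bar>correlation A f u $ i\<bar> = t \<Longrightarrow>
           0 \<le> c * correlation A f u $ i \<longleftrightarrow> 0 \<le> c * correlation A f u' $ i"
proof -
  have iff: "correlation A f u $ i = t \<longleftrightarrow> correlation A f u' $ i = t'"
      "correlation A f u $ i = - t \<longleftrightarrow> correlation A f u' $ i = - t'"
    using assms(1) by (auto simp: same_signs_def)
  have abs_iff: "\<bar>x\<bar> = s \<longleftrightarrow> x = s \<or> x = - s" if "s > 0" for x s :: real
    using that by auto
  show E: "\<bar>correlation A f u $ i\<bar> = t \<longleftrightarrow> \<bar>correlation A f u' $ i\<bar> = t'"
    unfolding abs_iff[OF assms(2)] abs_iff[OF assms(3)] iff ..
  assume "\<bar>correlation A f u $ i\<bar> = t"
  then have "correlation A f u $ i = t \<and> correlation A f u' $ i = t' \<or>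
      correlation A f u $ i = - t \<and> correlation A f u' $ i = - t'"
    using iff abs_iff[OF assms(2)] by blast
  then show "correlation A f u $ i / t = correlation A f u' $ i / t'"
      "0 \<le> c * correlation A f u $ i \<longleftrightarrow> 0 \<le> c * correlation A f u' $ i"
    using assms(2,3) by (auto simp: zero_le_mult_iff mult_le_0_iff)
qed

text \<open>Only the linear term of the least-squares problem involves t and u beyond the
  constraints. On the equicorrelation set, outside which admissible directions vanish, q/t is a
  vector of signs fixed by the pattern.\<close>

lemma direction_set_cong:
  assumes "sign_pattern A f t u = sign_pattern A f t' u'" "t > 0" "t' > 0"
  shows "direction_set A f t u = direction_set A f t' u'"
proof -
  have act: "u $ i = 0 \<longleftrightarrow> u' $ i = 0" for i
    using assms(1) by (auto simp: sign_pattern_eq_iff active_set_def set_eq_iff)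
  have signs: "same_signs A f t u t' u'"
    using assms(1) by (simp add: sign_pattern_eq_iff)
  note E = same_signs_equicorrelation[OF signs assms(2,3)]
  have adm: "admissible_directions A f t u = admissible_directions A f t' u'"
    unfolding admissible_directions_def using E(1,3) act by (intro Collect_cong) metis
  have "(1 / t) *\<^sub>R correlation A f u \<bullet> (x - d) = (1 / t') *\<^sub>R correlation A f u' \<bullet> (x - d)"
    if "x \<in> admissible_directions A f t u" "d \<in> admissible_directions A f t u" for x d
    unfolding inner_vec_def
  proof (intro sum.cong refl)
    fix i
    show "((1 / t) *\<^sub>R correlation A f u) $ i \<bullet> (x - d) $ i =
        ((1 / t') *\<^sub>R correlation A f u') $ i \<bullet> (x - d) $ i"
      using that E(2)[of i]
      by (cases "\<bar>correlation A f u $ i\<bar> = t") (auto simp: admissible_directions_def)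
  qed
  then show ?thesis
    unfolding set_eq_iff direction_set_iff[OF assms(2)] direction_set_iff[OF assms(3)]
    by (auto simp: inner_diff_left adm)
qed

text \<open>The correlation is affine along the segment. Where both ends touch the same bound, so do
  all points between, and the solution keeps its weak sign. Where both ends are strictly inside, so
  are all points between, and the solution coordinate is 0.\<close>

lemma lasso_kkt_interpolate:
  assumes kkt: "lasso_kkt A f t1 u1" "lasso_kkt A f t2 u2" and "t1 > 0" "t2 > 0"
    and signs: "same_signs A f t1 u1 t2 u2" and "0 \<le> \<theta>" "\<theta> \<le> 1"
  shows "lasso_kkt A f (t1 + \<theta> * (t2 - t1)) (u1 + \<theta> *\<^sub>R (u2 - u1)) \<and>
         same_signs A f t1 u1 (t1 + \<theta> * (t2 - t1)) (u1 + \<theta> *\<^sub>R (u2 - u1))"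
  (is "lasso_kkt A f ?t ?u \<and> _")
proof -
  have diff: "correlation A f u2 = correlation A f u1 - gram A (u2 - u1)"
    by (metis correlation_add add_diff_cancel_left' diff_add_cancel add.commute)
  have q: "correlation A f ?u $ i =
      (1 - \<theta>) * correlation A f u1 $ i + \<theta> * correlation A f u2 $ i" for i
    unfolding correlation_add_scaleR diff vector_minus_component
    by (simp add: left_diff_distrib right_diff_distrib)
  have t: "?t = (1 - \<theta>) * t1 + \<theta> * t2" and u: "?u $ i = (1 - \<theta>) * u1 $ i + \<theta> * u2 $ i" for i
    by (simp_all add: algebra_simps)
  have coord: "\<bar>correlation A f ?u $ i\<bar> \<le> ?t \<and>
      ?u $ i * correlation A f ?u $ i = ?t * \<bar>?u $ i\<bar> \<and>
      (correlation A f u1 $ i = t1 \<longleftrightarrow> correlation A f ?u $ i = ?t) \<and>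
      (correlation A f u1 $ i = - t1 \<longleftrightarrow> correlation A f ?u $ i = - ?t)" for i
  proof -
    let ?p = "correlation A f u1 $ i" and ?q = "correlation A f u2 $ i"
    have k: "\<bar>?p\<bar> \<le> t1" "\<bar>?q\<bar> \<le> t2" "u1 $ i * ?p = t1 * \<bar>u1 $ i\<bar>" "u2 $ i * ?q = t2 * \<bar>u2 $ i\<bar>"
      using kkt by (auto simp: lasso_kkt_def)
    have pos: "0 < ?t"
      unfolding t using assms(3,4,6,7)
      by (cases "\<theta> = 0") (auto intro: add_nonneg_pos)
    consider "?p = t1" "?q = t2" | "?p = - t1" "?q = - t2" | "\<bar>?p\<bar> < t1" "\<bar>?q\<bar> < t2"
    proof -
      have "?p = t1 \<or> ?p = - t1 \<or> \<bar>?p\<bar> < t1" "?q = t2 \<or> ?q = - t2 \<or> \<bar>?q\<bar> < t2"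
        using k(1,2) by linarith+
      then show thesis
        using signs that unfolding same_signs_def by blast
    qed
    then show ?thesis
    proof cases
      case 1
      then have q': "correlation A f ?u $ i = ?t" unfolding q t by simp
      have "0 \<le> u1 $ i" "0 \<le> u2 $ i" using 1 k(3,4) assms(3,4) by (auto simp: mult.commute)
      then have "0 \<le> ?u $ i" unfolding u using assms(6,7) by simp
      then show ?thesis unfolding q' using pos 1(1) assms(3) by simp
    next
      case 2
      then have q': "correlation A f ?u $ i = - ?t" unfolding q t by simp
      have nonpos: "v \<le> 0" if "v * (- s) = s * \<bar>v\<bar>" "0 < s" for v s :: real
      proof (rule ccontr)
        assume "\<not> v \<le> 0"
        then have "0 < v * s" using that(2) by simp
        then show False using that(1) \<open>\<not> v \<le> 0\<close> by (simp add: mult.commute)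
      qed
      have "u1 $ i \<le> 0" "u2 $ i \<le> 0"
        using nonpos[OF k(3)[unfolded 2(1)] assms(3)] nonpos[OF k(4)[unfolded 2(2)] assms(4)] .
      then have "?u $ i \<le> 0" unfolding u using assms(6,7)
        by (intro add_nonpos_nonpos mult_nonneg_nonpos) auto
      moreover have "v * (- s) = s * \<bar>v\<bar>" if "v \<le> 0" for v s :: real
        using that by simp
      ultimately have "?u $ i * (- ?t) = ?t * \<bar>?u $ i\<bar>" by blast
      moreover have "\<bar>- ?t\<bar> \<le> ?t" "- ?t \<noteq> ?t" "?p \<noteq> t1"
        using pos 2(1) assms(3) by auto
      ultimately show ?thesis unfolding q' using 2(1) by blast
    next
      case 3
      have inactive: "v = 0" if "\<bar>r\<bar> < s" "v * r = s * \<bar>v\<bar>" for r s v :: real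
      proof (rule ccontr)
        assume "v \<noteq> 0"
        then have "\<bar>v * r\<bar> < \<bar>v\<bar> * s" using that(1) by (simp add: abs_mult)
        then show False using that by (simp add: abs_mult)
      qed
      have "u1 $ i = 0" "u2 $ i = 0" using inactive[OF 3(1) k(3)] inactive[OF 3(2) k(4)] by auto
      then have "?u $ i = 0" unfolding u by simp
      moreover have "\<bar>correlation A f ?u $ i\<bar> < ?t"
      proof -
        have "\<bar>correlation A f ?u $ i\<bar> \<le> (1 - \<theta>) * \<bar>?p\<bar> + \<theta> * \<bar>?q\<bar>"
          unfolding q using assms(6,7) abs_triangle_ineq[of "(1 - \<theta>) * ?p" "\<theta> * ?q"]
          by (simp add: abs_mult)
        also have "\<dots> < ?t"
          unfolding t using assms(6,7) 3
          by (cases "\<theta> = 0") (auto intro!: add_le_less_mono mult_left_mono)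
        finally show ?thesis .
      qed
      ultimately show ?thesis using 3(1) pos by auto
    qed
  qed
  then show ?thesis unfolding lasso_kkt_def same_signs_def by blast
qed

text \<open>Both d and d' satisfy the normal equations on the common equicorrelation set, so an
  admissible point between them minimizes the old least-squares problem. The projection inequality
  for d at such a point near d gives 0 \<le> d \<bullet> (d' - d).\<close>

lemma min_norm_direction_increases:
  fixes A :: "real^'n^'m"
  assumes "0 < t'" "t' < t" and sol': "u' \<in> lasso_solutions A f t'"
    and u': "u' = u + (t - t') *\<^sub>R d"
    and signs: "same_signs A f t u t' u'"
    and d: "is_arg_min norm (\<lambda>d. d \<in> direction_set A f t u) d"
    and d': "is_arg_min norm (\<lambda>d. d \<in> direction_set A f t' u') d'"
    and gram': "\<And>i. \<bar>correlation A f u $ i\<bar> = t \<Longrightarrow> t * gram A d' $ i = correlation A f u $ i"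
    and blocked: "\<not> (\<forall>\<^sub>F \<tau> in at_left t'. u' + (t' - \<tau>) *\<^sub>R d \<in> lasso_solutions A f \<tau>)"
  shows "norm d < norm d'"
proof -
  have "0 < t" using assms by simp
  note E = same_signs_equicorrelation[OF signs \<open>0 < t\<close> \<open>0 < t'\<close>]
  have D: "d \<in> direction_set A f t u" and D': "d' \<in> direction_set A f t' u'"
    using d d' by (simp_all add: is_arg_min_linorder)
  then have adm: "d \<in> admissible_directions A f t u"
    and adm': "d' \<in> admissible_directions A f t' u'"
    using assms(1) \<open>0 < t\<close> by (simp_all add: direction_set_iff)
  \<comment> \<open>The correlation keeps the ratio q/t at both ends of the step, so its slope along
    d must be that ratio.\<close>
  have gram: "t * gram A d $ i = correlation A f u $ i" if "\<bar>correlation A f u $ i\<bar> = t" for i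
  proof -
    have "correlation A f u $ i - (t - t') * gram A d $ i = correlation A f u $ i / t * t'"
      using E[of i] that assms(1) by (simp add: u')
    then have "t * (correlation A f u $ i - (t - t') * gram A d $ i) = correlation A f u $ i * t'"
      using \<open>0 < t\<close> by simp
    then have "(t - t') * (t * gram A d $ i) = (t - t') * correlation A f u $ i"
      by (simp add: algebra_simps)
    then show ?thesis using assms(2) by simp
  qed
  \<comment> \<open>The new direction continues to produce solutions below t', while the old one is
    blocked there.\<close>
  have "d \<noteq> d'"
    using direction_eventually_solution[OF assms(1) sol' D'] blocked by auto
  define e where "e \<theta> = d + \<theta> *\<^sub>R (d' - d)" for \<theta>
  have "\<forall>\<^sub>F \<theta> in at_right 0. \<forall>i. \<bar>correlation A f u $ i\<bar> = t \<longrightarrow> u $ i = 0 \<longrightarrow>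
      0 \<le> e \<theta> $ i * correlation A f u $ i"
  proof (rule eventually_all_finite)
    fix i
    let ?q = "correlation A f u $ i"
    show "\<forall>\<^sub>F \<theta> in at_right 0. \<bar>?q\<bar> = t \<longrightarrow> u $ i = 0 \<longrightarrow> 0 \<le> e \<theta> $ i * ?q"
    proof (cases "\<bar>?q\<bar> = t \<and> u $ i = 0")
      case True
      then have dq: "0 \<le> d $ i * ?q"
        using adm by (simp add: admissible_directions_def)
      have u'_i: "u' $ i = (t - t') * d $ i"
        using True by (simp add: u')
      show ?thesis
      \<comment> \<open>If d_i = 0, then u'_i = 0 as well and d' obeys the sign constraint itself.
        Otherwise d_i satisfies it strictly, and a short move towards d' preserves this.\<close>
      proof (cases "d $ i = 0")
        case True
        then have "0 \<le> d' $ i * correlation A f u' $ i"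
          using adm' u'_i E(1)[of i] \<open>\<bar>?q\<bar> = t \<and> u $ i = 0\<close>
          by (auto simp: admissible_directions_def)
        then have "0 \<le> d' $ i * ?q"
          using E(3)[of i] \<open>\<bar>?q\<bar> = t \<and> u $ i = 0\<close> by simp
        then have "0 \<le> \<theta> * (d' $ i * ?q)" if "0 < \<theta>" for \<theta>
          using that by simp
        then have "0 < \<theta> \<Longrightarrow> 0 \<le> e \<theta> $ i * ?q" for \<theta>
          using True by (simp add: e_def mult.assoc)
        then show ?thesis
          by (auto simp: eventually_at_right[of 0 1] intro!: exI[of _ 1])
      next
        case False
        have "((\<lambda>\<theta>. e \<theta> $ i * ?q) \<longlongrightarrow> (d $ i + 0 * (d' $ i - d $ i)) * ?q) (at_right 0)"
          unfolding e_def vector_add_component vector_scaleR_component vector_minus_component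
            real_scaleR_def
          by (intro tendsto_intros)
        moreover have "0 < d $ i * ?q"
          using False dq True \<open>0 < t\<close> by (cases "?q = 0") (auto simp: less_le)
        ultimately have "\<forall>\<^sub>F \<theta> in at_right 0. 0 < e \<theta> $ i * ?q"
          by (intro order_tendstoD) auto
        then show ?thesis by eventually_elim simp
      qed
    qed auto
  qed
  moreover have "\<forall>\<^sub>F \<theta>::real in at_right 0. 0 < \<theta>"
    by (simp add: eventually_at_right_less)
  ultimately have "\<forall>\<^sub>F \<theta> in at_right 0. 0 < \<theta> \<and> e \<theta> \<in> admissible_directions A f t u"
  proof eventually_elim
    case (elim \<theta>)
    have "e \<theta> $ i = 0" if "\<bar>correlation A f u $ i\<bar> \<noteq> t" for i
      using adm adm' E(1)[of i] that by (simp add: e_def admissible_directions_def)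
    then show ?case using elim by (simp add: admissible_directions_def)
  qed
  then obtain \<theta> where \<theta>: "0 < \<theta>" "e \<theta> \<in> admissible_directions A f t u"
    using eventually_happens[of _ "at_right (0::real)"] by (auto simp: trivial_limit_at_right_real)
  have "e \<theta> \<in> direction_set A f t u"
  proof (rule direction_setI[OF \<open>0 < t\<close> \<theta>(2)])
    fix i assume i: "\<bar>correlation A f u $ i\<bar> = t"
    have "d' = d + (d' - d)" by simp
    then have "gram A (d' - d) = gram A d' - gram A d"
      by (metis gram_add add_diff_cancel_left')
    then have "gram A (e \<theta>) $ i = gram A d $ i + \<theta> * (gram A d' $ i - gram A d $ i)"
      by (simp add: e_def gram_add gram_scaleR)
    then have "t * gram A (e \<theta>) $ i = t * (gram A d $ i + \<theta> * (gram A d' $ i - gram A d $ i))"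
      by simp
    also have "\<dots> = t * gram A d $ i + \<theta> * (t * gram A d' $ i - t * gram A d $ i)"
      by (simp add: algebra_simps)
    also have "\<dots> = correlation A f u $ i"
      using gram[OF i] gram'[OF i] by simp
    finally show "t * gram A (e \<theta>) $ i = correlation A f u $ i" .
  qed
  then have "0 \<le> d \<bullet> (e \<theta> - d)"
    using d by (simp add: min_norm_iff convex_direction_set \<open>0 < t\<close>)
  then have "0 \<le> d \<bullet> (d' - d)"
    using \<theta>(1) by (simp add: e_def zero_le_mult_iff)
  then show ?thesis using min_norm_less \<open>d \<noteq> d'\<close> by metis
qed

text \<open>The directions are assumed up to index j inclusive, because the contradiction compares
  the direction leaving the first occurrence of the pattern with the one leaving the second.\<close>

lemma sign_patterns_distinct:
  fixes A :: "real^'n^'m" and d :: "nat \<Rightarrow> real^'n"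
  assumes "i < j" and pos: "\<And>l. l \<le> j \<Longrightarrow> 0 < t l"
    and sol: "\<And>l. l \<le> j \<Longrightarrow> u l \<in> lasso_solutions A f (t l)"
    and dir: "\<And>l. l \<le> j \<Longrightarrow>
      homotopy_direction A f (t l) (u l) (t (Suc l)) (u (Suc l)) (d l)"
  shows "sign_pattern A f (t i) (u i) \<noteq> sign_pattern A f (t j) (u j)"
proof
  assume same: "sign_pattern A f (t i) (u i) = sign_pattern A f (t j) (u j)"
  have dec: "t (Suc l) < t l" and u: "u (Suc l) = u l + (t l - t (Suc l)) *\<^sub>R d l"
    and d: "is_arg_min norm (\<lambda>d. d \<in> direction_set A f (t l) (u l)) (d l)" if "l \<le> j" for l
    using dir[OF that] by (simp_all add: homotopy_direction_def)
  have anti: "t b \<le> t a" if "a \<le> b" "b \<le> j" for a b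
    using that
  proof (induction b rule: dec_induct)
    case (step n)
    then show ?case using dec[of n] by auto
  qed simp
  have "t j < t i"
    using anti[of "Suc i" j] dec[of i] \<open>i < j\<close> by simp
  \<comment> \<open>The interpolated point need not be \<open>u l\<close>, but both solve the
    problem at \<open>t l\<close> and so have the same correlation.\<close>
  have signs: "same_signs A f (t i) (u i) (t l) (u l)" if l: "i \<le> l" "l \<le> j" for l
  proof -
    define \<theta> where "\<theta> = (t i - t l) / (t i - t j)"
    have \<theta>: "0 \<le> \<theta>" "\<theta> \<le> 1" "t i + \<theta> * (t j - t i) = t l"
      using anti[of i l] anti[of l j] l \<open>t j < t i\<close> by (auto simp: \<theta>_def divide_simps algebra_simps)
    have "lasso_kkt A f (t i) (u i)" "lasso_kkt A f (t j) (u j)"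
      using sol pos \<open>i < j\<close> by (auto simp flip: lasso_solution_iff_kkt)
    then have "lasso_kkt A f (t l) (u i + \<theta> *\<^sub>R (u j - u i)) \<and>
        same_signs A f (t i) (u i) (t l) (u i + \<theta> *\<^sub>R (u j - u i))"
      using lasso_kkt_interpolate[of A f "t i" "u i" "t j" "u j" \<theta>] same \<theta> pos \<open>i < j\<close>
      by (simp add: sign_pattern_eq_iff)
    moreover have "lasso_kkt A f (t l) (u l)"
      using sol pos l by (simp flip: lasso_solution_iff_kkt)
    ultimately show ?thesis
      unfolding same_signs_def using lasso_kkt_correlation_unique by metis
  qed
  have E: "\<bar>correlation A f (u i) $ k\<bar> = t i \<longleftrightarrow> \<bar>correlation A f (u l) $ k\<bar> = t l"
      "\<bar>correlation A f (u i) $ k\<bar> = t i \<Longrightarrow> correlation A f (u i) $ k / t i = correlation A f (u l) $ k / t l"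
    if "i \<le> l" "l \<le> j" for l k
    using same_signs_equicorrelation[OF signs[OF that]] pos that \<open>i < j\<close> by auto
  have gram: "gram A (d l) $ k = correlation A f (u i) $ k / t i"
    if l: "i \<le> l" "l < j" and k: "\<bar>correlation A f (u i) $ k\<bar> = t i" for l k
  proof -
    define s where "s = correlation A f (u i) $ k / t i"
    have s: "correlation A f (u l') $ k = s * t l'" if "i \<le> l'" "l' \<le> j" for l'
      using E(2)[OF that k] pos[OF that(2)] by (simp add: s_def)
    have "correlation A f (u (Suc l)) $ k =
        correlation A f (u l) $ k - (t l - t (Suc l)) * gram A (d l) $ k"
      unfolding u[OF less_imp_le[OF l(2)]] by (rule correlation_add_scaleR)
    then have "(t l - t (Suc l)) * gram A (d l) $ k = (t l - t (Suc l)) * s"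
      using s[of l] s[of "Suc l"] l by (simp add: algebra_simps)
    then show ?thesis using dec[of l] l by (simp flip: s_def)
  qed
  have "d j = d i"
    using d[of i] d[of j] pos[of i] pos[of j] \<open>i < j\<close>
      direction_set_cong[OF same] min_norm_unique[OF convex_direction_set] by simp
  have gram': "t l * gram A (d (Suc l)) $ k = correlation A f (u l) $ k"
    if l: "i \<le> l" "l < j" and k: "\<bar>correlation A f (u l) $ k\<bar> = t l" for l k
  proof -
    have ki: "\<bar>correlation A f (u i) $ k\<bar> = t i"
      using E(1)[of l k] l k by simp
    have "gram A (d (Suc l)) $ k = correlation A f (u i) $ k / t i"
    \<comment> \<open>The slope formula covers only steps ending at or before j. For the step
      leaving j, the equality of \<open>d j\<close> and \<open>d i\<close> closes the cycle.\<close>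
    proof (cases "Suc l = j")
      case True
      then show ?thesis using gram[of i k] \<open>d j = d i\<close> ki \<open>i < j\<close> by simp
    next
      case False
      then show ?thesis using gram[of "Suc l" k] ki l by simp
    qed
    then show ?thesis using E(2)[of l k] ki l pos[of l] by simp
  qed
  have less: "norm (d l) < norm (d (Suc l))" if l: "i \<le> l" "l < j" for l
  proof (rule min_norm_direction_increases)
    show "same_signs A f (t l) (u l) (t (Suc l)) (u (Suc l))"
      using signs[of l] signs[of "Suc l"] l by (simp add: same_signs_def)
    show "0 < t (Suc l)" "t (Suc l) < t l" "u (Suc l) \<in> lasso_solutions A f (t (Suc l))"
        "u (Suc l) = u l + (t l - t (Suc l)) *\<^sub>R d l"
      using l by (simp_all add: pos dec sol u[symmetric])
    show "is_arg_min norm (\<lambda>d. d \<in> direction_set A f (t l) (u l)) (d l)"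
        "is_arg_min norm (\<lambda>d. d \<in> direction_set A f (t (Suc l)) (u (Suc l))) (d (Suc l))"
      using l by (simp_all add: d)
    show "t l * gram A (d (Suc l)) $ k = correlation A f (u l) $ k"
      if "\<bar>correlation A f (u l) $ k\<bar> = t l" for k
      using gram' l that by simp
    show "\<not> (\<forall>\<^sub>F \<tau> in at_left (t (Suc l)).
        u (Suc l) + (t (Suc l) - \<tau>) *\<^sub>R d l \<in> lasso_solutions A f \<tau>)"
      using dir[of l] pos[of "Suc l"] l unfolding homotopy_direction_def by auto
  qed
  have "norm (d i) < norm (d l)" if "Suc i \<le> l" "l \<le> j" for l
    using that
  proof (induction l rule: dec_induct)
    case base
    show ?case using less[of i] \<open>i < j\<close> by simp
  next
    case (step n)
    then show ?case using less[of n] by force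
  qed
  from this[of j] show False using \<open>d j = d i\<close> \<open>i < j\<close> by simp
qed

section \<open>Runs of the homotopy method\<close>

text \<open>The case t = 0 is included: then A^T f = 0 and the method stops at once with the zero
  vector.\<close>

lemma zero_lasso_solution:
  assumes "infnorm (transpose A *v f) \<le> t"
  shows "0 \<in> lasso_solutions A f t"
proof -
  have corr: "\<bar>correlation A f 0 $ i\<bar> \<le> t" for i
    using component_le_infnorm_cart[of "transpose A *v f" i] assms
    by (simp add: correlation_def)
  show ?thesis
  proof (cases "t = 0")
    case True
    then have "correlation A f 0 = 0" using corr by (simp add: vec_eq_iff)
    then show ?thesis
      unfolding True by (rule lasso_solution_zero) (simp add: l1_norm_def sum_nonneg)
  next
    case False
    then have "0 < t" using assms infnorm_pos_le[of "transpose A *v f"] by linarith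
    then show ?thesis
      using corr by (simp add: lasso_solution_iff_kkt lasso_kkt_def)
  qed
qed

lemma homotopy_run_Suc:
  "homotopy_run A f (Suc K) t u \<longleftrightarrow>
     homotopy_run A f K t u \<and> homotopy_step A f (t K) (u K) (t (Suc K)) (u (Suc K))"
  by (auto simp: homotopy_run_def less_Suc_eq)

lemma homotopy_run_invariant:
  fixes A :: "real^'n^'m"
  assumes "homotopy_run A f K t u"
  shows "0 \<le> t K \<and> u K \<in> lasso_solutions A f (t K)"
  using assms
proof (induction K)
  case 0
  then show ?case
    by (simp add: homotopy_run_def infnorm_pos_le zero_lasso_solution del: transpose_matrix_vector)
next
  case (Suc K)
  then have step: "homotopy_step A f (t K) (u K) (t (Suc K)) (u (Suc K))"
      and inv: "0 \<le> t K" "u K \<in> lasso_solutions A f (t K)"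
    by (auto simp: homotopy_run_Suc)
  then have "0 < t K" by (simp add: homotopy_step_def)
  with homotopy_step_direction[OF step] inv(2) obtain d
    where "homotopy_direction A f (t K) (u K) (t (Suc K)) (u (Suc K)) d" by blast
  then show ?case by (simp add: homotopy_direction_def)
qed

lemma homotopy_run_mono: "homotopy_run A f K t u \<Longrightarrow> L \<le> K \<Longrightarrow> homotopy_run A f L t u"
  by (auto simp: homotopy_run_def)

lemma homotopy_run_pos:
  assumes "homotopy_run A f K t u" "j < K"
  shows "0 < t j"
proof -
  have "0 \<le> t j"
    using homotopy_run_invariant[OF homotopy_run_mono[OF assms(1)], of j] assms(2) by simp
  moreover have "t j \<noteq> 0"
    using assms by (auto simp: homotopy_run_def homotopy_step_def)
  ultimately show ?thesis by simp
qed

lemma homotopy_run_directions: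
  fixes A :: "real^'n^'m"
  assumes run: "homotopy_run A f K t u"
  shows "\<exists>d. \<forall>l<K. homotopy_direction A f (t l) (u l) (t (Suc l)) (u (Suc l)) (d l)"
proof -
  have "\<exists>d. homotopy_direction A f (t l) (u l) (t (Suc l)) (u (Suc l)) d" if "l < K" for l
  proof (rule homotopy_step_direction)
    show "homotopy_step A f (t l) (u l) (t (Suc l)) (u (Suc l))"
      using run that by (simp add: homotopy_run_def)
    show "0 < t l" by (rule homotopy_run_pos[OF run that])
    show "u l \<in> lasso_solutions A f (t l)"
      using homotopy_run_invariant[OF homotopy_run_mono[OF run, of l]] that by simp
  qed
  then show ?thesis by metis
qed

section \<open>Termination and uniqueness of the output\<close>

lemma homotopy_run_length_bound:
  fixes A :: "real^'n^'m"
  assumes run: "homotopy_run A f K t u"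
  shows "K \<le> card (UNIV :: ('n set \<times> 'n set \<times> 'n set) set)"
proof -
  obtain d where d: "\<forall>l<K. homotopy_direction A f (t l) (u l) (t (Suc l)) (u (Suc l)) (d l)"
    using homotopy_run_directions[OF run] ..
  have neq: "sign_pattern A f (t i) (u i) \<noteq> sign_pattern A f (t j) (u j)" if "i < j" "j < K" for i j
  proof (rule sign_patterns_distinct[of i j t u A f d])
    fix l assume "l \<le> j"
    then have "l < K" using that by simp
    show "0 < t l" by (rule homotopy_run_pos[OF run \<open>l < K\<close>])
    show "u l \<in> lasso_solutions A f (t l)"
      using homotopy_run_invariant[OF homotopy_run_mono[OF run, of l]] \<open>l < K\<close> by simp
    show "homotopy_direction A f (t l) (u l) (t (Suc l)) (u (Suc l)) (d l)"
      using d \<open>l < K\<close> by blast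
  qed (rule \<open>i < j\<close>)
  \<comment> \<open>Only the K starting points of steps are counted; the final parameter may be
    0.\<close>
  have "inj_on (\<lambda>l. sign_pattern A f (t l) (u l)) {..<K}"
  proof (rule inj_onI)
    fix i j assume "i \<in> {..<K}" "j \<in> {..<K}"
      and "sign_pattern A f (t i) (u i) = sign_pattern A f (t j) (u j)"
    then show "i = j" using neq[of i j] neq[of j i] by (cases i j rule: linorder_cases) auto
  qed
  then have "card {..<K} \<le> card (UNIV :: ('n set \<times> 'n set \<times> 'n set) set)"
    by (rule card_inj_on_le) auto
  then show ?thesis by simp
qed

text \<open>If no run ever reached parameter 0, every run could be extended by one more step,
  contradicting the uniform bound on lengths.\<close>

lemma homotopy_output_exists:
  fixes A :: "real^'n^'m"
  shows "\<exists>K t u. homotopy_output A f K t u"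
proof (rule ccontr)
  assume no: "\<nexists>K t u. homotopy_output A f K t u"
  have "\<exists>t u. homotopy_run A f K t u" for K
  proof (induction K)
    case 0
    show ?case
      by (rule exI[of _ "\<lambda>_. infnorm (transpose A *v f)"], rule exI[of _ "\<lambda>_. 0"])
        (simp add: homotopy_run_def)
  next
    case (Suc K)
    then obtain t u where run: "homotopy_run A f K t u" by blast
    then have "t K \<noteq> 0" using no by (auto simp: homotopy_output_def)
    then obtain t' u' where "homotopy_step A f (t K) (u K) t' u'"
      using homotopy_step_exists homotopy_run_invariant[OF run] by (metis less_eq_real_def)
    then have "homotopy_run A f (Suc K) (t(Suc K := t')) (u(Suc K := u'))"
      using run by (auto simp: homotopy_run_def less_Suc_eq)
    then show ?case by blast
  qed
  then obtain t u where
    "homotopy_run A f (Suc (card (UNIV :: ('n set \<times> 'n set \<times> 'n set) set))) t u" by blast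
  then show False using homotopy_run_length_bound by fastforce
qed

lemma homotopy_run_unique:
  fixes A :: "real^'n^'m"
  assumes "homotopy_run A f K t u" "homotopy_run A f K t' u'"
  shows "j \<le> K \<Longrightarrow> t' j = t j \<and> u' j = u j"
proof (induction j)
  case 0
  then show ?case using assms by (simp add: homotopy_run_def)
next
  case (Suc j)
  then have "homotopy_step A f (t j) (u j) (t (Suc j)) (u (Suc j))"
      "homotopy_step A f (t j) (u j) (t' (Suc j)) (u' (Suc j))"
    using assms by (auto simp: homotopy_run_def Suc_le_eq)
  then show ?case
    using homotopy_step_unique homotopy_run_pos[OF assms(1), of j] Suc.prems by (metis Suc_le_eq)
qed

text \<open>Steps are deterministic and none leaves parameter 0, so no execution continues past
  K.\<close>

lemma homotopy_output_unique:
  fixes A :: "real^'n^'m"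
  assumes out: "homotopy_output A f K t u" and run: "homotopy_run A f L t' u'"
  shows "L \<le> K \<and> (\<forall>j\<le>L. t' j = t j \<and> u' j = u j)"
proof -
  have K: "homotopy_run A f K t u" "t K = 0" using out by (auto simp: homotopy_output_def)
  have "L \<le> K"
  proof (rule ccontr)
    assume "\<not> L \<le> K"
    then have "t' K = t K"
      using homotopy_run_unique[OF K(1) homotopy_run_mono[OF run]] by simp
    then show False
      using homotopy_run_pos[OF run, of K] \<open>\<not> L \<le> K\<close> K(2) by simp
  qed
  then show ?thesis
    using homotopy_run_unique[OF homotopy_run_mono[OF K(1)] run] by blast
qed

section \<open>The solution path between and at the breakpoints\<close>

lemma homotopy_path_on_segment:
  assumes run: "homotopy_run A f K t u" and "\<And>l. l < K \<Longrightarrow> t (Suc l) < t l"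
    and u: "\<And>l. l < K \<Longrightarrow> u (Suc l) = u l + (t l - t (Suc l)) *\<^sub>R d l"
    and "j < K" "s \<in> {t (Suc j)..t j}"
  shows "homotopy_path K t u s = u j + (t j - s) *\<^sub>R d j"
proof -
  have *: "homotopy_path K t u s = u k + (t k - s) *\<^sub>R d k" if "k < K" "s \<in> {t (Suc k)..<t k}" for k s
  proof -
    have "homotopy_path K t u s = ((s - t (Suc k)) / (t k - t (Suc k))) *\<^sub>R u k +
        ((t k - s) / (t k - t (Suc k))) *\<^sub>R u (Suc k)"
      using homotopy_path_eq[of K t "Suc k" s u] assms(2) that by simp
    also have "\<dots> = ((s - t (Suc k)) / (t k - t (Suc k)) + (t k - s) / (t k - t (Suc k))) *\<^sub>R u k +
        ((t k - s) / (t k - t (Suc k)) * (t k - t (Suc k))) *\<^sub>R d k"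
      by (simp only: u[OF that(1)] scaleR_add_right scaleR_add_left scaleR_scaleR add.assoc)
    also have "(s - t (Suc k)) / (t k - t (Suc k)) + (t k - s) / (t k - t (Suc k)) = 1"
      using assms(2)[OF that(1)] by (simp flip: add_divide_distrib)
    also have "(t k - s) / (t k - t (Suc k)) * (t k - t (Suc k)) = t k - s"
      using assms(2)[OF that(1)] by simp
    finally show ?thesis by simp
  qed
  show ?thesis
  proof (cases "s < t j")
    case True
    then show ?thesis using * assms(4,5) by simp
  next
    case False
    \<comment> \<open>At the upper end the definition of the path uses the preceding segment, or the
      zero branch if j = 0. Agreement there allows closed segments to be glued.\<close>
    then have s: "s = t j" using assms(5) by simp
    show ?thesis
    proof (cases j)
      case 0
      then show ?thesis using s run by (simp add: homotopy_path_def homotopy_run_def)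
    next
      case (Suc k)
      then have "t (Suc k) < t k" "k < K" "homotopy_path K t u s = u k + (t k - t (Suc k)) *\<^sub>R d k"
        using * [of k s] assms(2)[of k] assms(4) s by auto
      then show ?thesis using u[of k] s Suc by simp
    qed
  qed
qed

text \<open>The second conjunct makes termination a statement about every execution: each partial
  run is a prefix of the output, which is therefore unique.\<close>

theorem theorem4p2:
  fixes A :: "real^'n^'m" and f :: "real^'m"
  shows "(\<exists>K t u. homotopy_output A f K t u) \<and>
         (\<forall>K t u L t' u'. homotopy_output A f K t u \<longrightarrow> homotopy_run A f L t' u' \<longrightarrow>
            L \<le> K \<and> (\<forall>j\<le>L. t' j = t j \<and> u' j = u j)) \<and>
         (\<forall>K t u. homotopy_output A f K t u \<longrightarrow>
            (\<forall>j<K. t (Suc j) < t j) \<and>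
            piecewise_linear_on {0..} (homotopy_path K t u) \<and>
            continuous_on {0..} (homotopy_path K t u) \<and>
            (\<forall>s>0. homotopy_path K t u s \<in> lasso_solutions A f s) \<and>
            homotopy_path K t u 0 \<in> lasso_solutions A f 0)"
proof (intro conjI allI impI)
  show "\<exists>K t u. homotopy_output A f K t u" by (rule homotopy_output_exists)
next
  fix K L :: nat and t t' u u' j
  assume "homotopy_output A f K t u" "homotopy_run A f L t' u'"
  from homotopy_output_unique[OF this]
  show "L \<le> K" "j \<le> L \<Longrightarrow> t' j = t j" "j \<le> L \<Longrightarrow> u' j = u j" by auto
next
  fix K :: nat and t u
  assume out: "homotopy_output A f K t u"
  then have run: "homotopy_run A f K t u" and "t K = 0" by (auto simp: homotopy_output_def)
  obtain d where d: "\<forall>l<K. homotopy_direction A f (t l) (u l) (t (Suc l)) (u (Suc l)) (d l)"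
    using homotopy_run_directions[OF run] ..
  have dec: "t (Suc l) < t l" and u: "u (Suc l) = u l + (t l - t (Suc l)) *\<^sub>R d l"
    and sol: "\<tau> \<in> {t (Suc l)..t l} \<Longrightarrow> u l + (t l - \<tau>) *\<^sub>R d l \<in> lasso_solutions A f \<tau>"
    if "l < K" for l \<tau>
    using d that unfolding homotopy_direction_def by blast+
  let ?path = "homotopy_path K t u"
  note path = homotopy_path_on_segment[OF run dec u]
  \<comment> \<open>Finitely many closed pieces, on each of which the path is affine, so that
    continuity follows by gluing.\<close>
  define P where "P = insert {t 0..} ((\<lambda>j. {t (Suc j)..t j}) ` {..<K})"
  have t0: "t 0 = infnorm (transpose A *v f)" using run by (simp add: homotopy_run_def)
  have cover: "\<exists>J\<in>P. s \<in> J" if "0 \<le> s" for s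
  proof (cases "t 0 \<le> s")
    case False
    \<comment> \<open>The first breakpoint at or below s; its predecessor lies above s.\<close>
    define k where "k = (LEAST k. t k \<le> s)"
    have k: "t k \<le> s" "\<And>l. l < k \<Longrightarrow> \<not> t l \<le> s"
      unfolding k_def using LeastI[of "\<lambda>k. t k \<le> s" K] that \<open>t K = 0\<close> by (auto dest: not_less_Least)
    have "k \<le> K" unfolding k_def using that \<open>t K = 0\<close> by (intro Least_le) simp
    obtain j where "k = Suc j" using k(1) False by (cases k) auto
    then have "j < K" "s \<in> {t (Suc j)..t j}" using k(1) k(2)[of j] \<open>k \<le> K\<close> by auto
    then show ?thesis by (auto simp: P_def)
  qed (auto simp: P_def)
  have nonneg: "0 \<le> t l" if "l \<le> K" for l
    using homotopy_run_invariant[OF homotopy_run_mono[OF run that]] by simp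
  have "0 \<le> t (Suc l)" if "l < K" for l
    using nonneg[of "Suc l"] that by simp
  then have Union: "\<Union>P = {0..}"
    using nonneg[of 0] cover by (force simp: P_def)
  have affine: "\<exists>a b. \<forall>s\<in>J. ?path s = a + s *\<^sub>R b" if J: "J \<in> P" for J
  proof -
    consider "J = {t 0..}" | j where "j < K" "J = {t (Suc j)..t j}"
      using J unfolding P_def by blast
    then show ?thesis
    proof cases
      case 1
      then show ?thesis by (intro exI[of _ 0]) (simp add: homotopy_path_def)
    next
      case 2
      then have "\<forall>s\<in>J. ?path s = (u j + t j *\<^sub>R d j) + s *\<^sub>R (- d j)"
        using path by (simp add: scaleR_left_diff_distrib)
      then show ?thesis by blast
    qed
  qed
  show "t (Suc j) < t j" if "j < K" for j using dec that .
  show "piecewise_linear_on {0..} ?path"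
    unfolding piecewise_linear_on_def
    by (intro exI[of _ P] conjI ballI affine Union)
      (auto simp: P_def is_interval_ci is_interval_cc)
  have "continuous_on (\<Union>J\<in>P. J) ?path"
  proof (rule continuous_on_closed_Union)
    fix J assume "J \<in> P"
    from affine[OF this] obtain a b where "\<forall>s\<in>J. ?path s = a + s *\<^sub>R b" by blast
    moreover have "continuous_on J (\<lambda>s. a + s *\<^sub>R b)" by (intro continuous_intros)
    ultimately show "continuous_on J ?path" by (simp cong: continuous_on_cong)
  qed (auto simp: P_def)
  then show "continuous_on {0..} ?path" by (simp add: Union)
  have path_sol: "?path s \<in> lasso_solutions A f s" if s: "0 \<le> s" for s
  proof -
    obtain J where "J \<in> P" "s \<in> J" using cover[OF s] by blast
    then consider "t 0 \<le> s" | j where "j < K" "s \<in> {t (Suc j)..t j}"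
      by (auto simp: P_def)
    then show ?thesis
    proof cases
      case 1
      then show ?thesis using t0 zero_lasso_solution[of A f s] by (simp add: homotopy_path_def)
    next
      case 2
      then show ?thesis using path sol by simp
    qed
  qed
  show "?path s \<in> lasso_solutions A f s" if "0 < s" for s
    using path_sol that by simp
  show "?path 0 \<in> lasso_solutions A f 0"
    using path_sol by simp
qed

end
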